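(* Let $\mathcal{T}$ be a triangle with circumcircle $\mathcal{C}$, and let $D$ be a point lying neither on the sides of $\mathcal{T}$ nor on $\mathcal{C}$. Let $\mathcal{T}_D$ be the negative-pedal triangle of $\mathcal{T}$ with respect to $D$, and $\mathcal{C}_D$ the circumcircle of $\mathcal{T}_D$. Let $A$ be a point of $\mathcal{C}$, let $a'$ be the perpendicular at $A$ to $DA$, and let $B',C'$ be the intersections of $a'$ and $\mathcal{C}_D$. Let the circles of diameters $[B'D]$ and $[C'D]$ intersect the circumcircle $\mathcal{C}$ again in $C$ and $B$, respectively, and let $A'$ be the intersection of $BC'$ and $CB'$. Then: (I i) the negative-pedal triangle of $ABC$ is $A'B'C'$; equivalently, $ABC$ is the pedal triangle of $A'B'C'$; (I ii) the circumcircle of $A'B'C'$ is $\mathcal{C}_D$; equivalently, the negative-pedal circle of $ABC$ is $\mathcal{C}_D$; the pedal-circle of $A'B'C'$ is $\mathcal{C}$. (II) If any of these intersections is empty, the process stops. This happens if the initial point $A$ was located on an "infertile" arc $D_1D_2$ of $\mathcal{C}$.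
   Context: All objects are in the Euclidean plane. A "side" of a triangle means the line through two of its vertices. Pedal and negative-pedal triangles and circles are all with respect to $D$: the pedal triangle of a triangle has as vertices the projections of $D$ on its sides, and its circumcircle is the pedal-circle; the negative-pedal triangle is the triangle whose sides are the perpendiculars, through each vertex $V$ of the given triangle, to the line $DV$, and its circumcircle is the negative-pedal circle. Let $\gamma_D$ be the i-conic of $\mathcal{T}$ focused in $D$, i.e. the conic having $D$ as a focus and tangent to the three sides of $\mathcal{T}$. An infertile arc $D_1D_2$ is an arc of $\mathcal{C}$, delimited by points $D_1,D_2$ where $\mathcal{C}$ meets $\gamma_D$, that lies inside $\gamma_D$ (points inside a conic being those in the same connected component of the plane minus the conic as one of its foci). *)

theory Defs
  imports "HOL-Analysis.Analysis"
begin

type_synonym point = "real^2"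

abbreviation line_through :: "point \<Rightarrow> point \<Rightarrow> point set" where
  "line_through X Y \<equiv> affine hull {X, Y}"

abbreviation triangle :: "point \<Rightarrow> point \<Rightarrow> point \<Rightarrow> bool" where
  "triangle X Y Z \<equiv> \<not> collinear {X, Y, Z}"

definition circumcircle_of :: "point set \<Rightarrow> point \<Rightarrow> point \<Rightarrow> point \<Rightarrow> bool" where
  "circumcircle_of S X Y Z \<longleftrightarrow>
     triangle X Y Z \<and> (\<exists>c r. S = sphere c r) \<and> X \<in> S \<and> Y \<in> S \<and> Z \<in> S"

definition circle_with_diameter :: "point \<Rightarrow> point \<Rightarrow> point set" where
  "circle_with_diameter X Y = sphere (midpoint X Y) (dist X Y / 2)"

text \<open>The perpendicular at \<open>V\<close> to the line \<open>DV\<close>; it is a line only if \<open>V \<noteq> D\<close>.\<close>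

definition perpendicular_at :: "point \<Rightarrow> point \<Rightarrow> point set" where
  "perpendicular_at D V = {X. (X - V) \<bullet> (D - V) = 0}"

text \<open>In both predicates below, the given triangle \<open>XYZ\<close> comes first and the derived triangle
  last. Corresponding letters match: the side opposite \<open>X'\<close> of the negative-pedal triangle is
  the one through \<open>X\<close>, and \<open>X'\<close> of the pedal triangle lies on the side opposite \<open>X\<close>.\<close>

definition negative_pedal_triangle ::
  "point \<Rightarrow> point \<Rightarrow> point \<Rightarrow> point \<Rightarrow> point \<Rightarrow> point \<Rightarrow> point \<Rightarrow> bool" where
  "negative_pedal_triangle D X Y Z X' Y' Z' \<longleftrightarrow>
     triangle X Y Z \<and> triangle X' Y' Z' \<and>
     line_through Y' Z' = perpendicular_at D X \<and>
     line_through Z' X' = perpendicular_at D Y \<and>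
     line_through X' Y' = perpendicular_at D Z"

definition pedal_triangle ::
  "point \<Rightarrow> point \<Rightarrow> point \<Rightarrow> point \<Rightarrow> point \<Rightarrow> point \<Rightarrow> point \<Rightarrow> bool" where
  "pedal_triangle D X Y Z X' Y' Z' \<longleftrightarrow>
     triangle X Y Z \<and> triangle X' Y' Z' \<and>
     X' = closest_point (line_through Y Z) D \<and>
     Y' = closest_point (line_through Z X) D \<and>
     Z' = closest_point (line_through X Y) D"

definition negative_pedal_circle ::
  "point \<Rightarrow> point \<Rightarrow> point \<Rightarrow> point \<Rightarrow> point set \<Rightarrow> bool" where
  "negative_pedal_circle D X Y Z S \<longleftrightarrow>
     (\<exists>X' Y' Z'. negative_pedal_triangle D X Y Z X' Y' Z' \<and> circumcircle_of S X' Y' Z')"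

definition pedal_circle ::
  "point \<Rightarrow> point \<Rightarrow> point \<Rightarrow> point \<Rightarrow> point set \<Rightarrow> bool" where
  "pedal_circle D X Y Z S \<longleftrightarrow>
     (\<exists>X' Y' Z'. pedal_triangle D X Y Z X' Y' Z' \<and> circumcircle_of S X' Y' Z')"


subsection \<open>Conics\<close>

text \<open>\<open>conic_with_foci G Fs\<close>: \<open>G\<close> is a nondegenerate conic whose set of foci is \<open>Fs\<close>. A circle is
  the ellipse with equal foci; both branches of a hyperbola are included.\<close>

definition conic_with_foci :: "point set \<Rightarrow> point set \<Rightarrow> bool" where
  "conic_with_foci G Fs \<longleftrightarrow>
     (\<exists>F1 F2 a. dist F1 F2 < 2 * a \<and>
        G = {X. dist X F1 + dist X F2 = 2 * a} \<and> Fs = {F1, F2}) \<or>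
     (\<exists>F1 F2 a. 0 < a \<and> 2 * a < dist F1 F2 \<and>
        G = {X. \<bar>dist X F1 - dist X F2\<bar> = 2 * a} \<and> Fs = {F1, F2}) \<or>
     (\<exists>F U V. U \<noteq> V \<and> F \<notin> line_through U V \<and>
        G = {X. dist X F = infdist X (line_through U V)} \<and> Fs = {F})"

text \<open>The line \<open>L\<close> touches the curve \<open>G\<close> at \<open>T\<close>: the angle between \<open>L\<close> and the chord \<open>TX\<close>
  tends to \<open>0\<close> as \<open>X\<close> tends to \<open>T\<close> along \<open>G\<close>. The quotient is the sine of that angle.\<close>

definition touches_at :: "point set \<Rightarrow> point set \<Rightarrow> point \<Rightarrow> bool" where
  "touches_at L G T \<longleftrightarrow>
     T \<in> L \<and> T \<in> G \<and> ((\<lambda>X. infdist X L / dist X T) \<longlongrightarrow> 0) (at T within G)"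

definition asymptote_of :: "point set \<Rightarrow> point set \<Rightarrow> bool" where
  "asymptote_of L G \<longleftrightarrow> ((\<lambda>X. infdist X G) \<longlongrightarrow> 0) (inf at_infinity (principal L))"

text \<open>An asymptote counts as a tangent, with its point of contact at infinity. Otherwise, for
  exceptional positions of the focus (the center of the conic lying on a side), there would be no
  conic with that focus tangent to the three sides of the triangle.\<close>

definition tangent_to :: "point set \<Rightarrow> point set \<Rightarrow> bool" where
  "tangent_to L G \<longleftrightarrow> (\<exists>T. touches_at L G T) \<or> asymptote_of L G"

definition i_conic ::
  "point \<Rightarrow> point \<Rightarrow> point \<Rightarrow> point \<Rightarrow> point set \<Rightarrow> point set \<Rightarrow> bool" where
  "i_conic D X Y Z G Fs \<longleftrightarrow>
     conic_with_foci G Fs \<and> D \<in> Fs \<and>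
     tangent_to (line_through Y Z) G \<and>
     tangent_to (line_through Z X) G \<and>
     tangent_to (line_through X Y) G"

definition inside_conic :: "point set \<Rightarrow> point set \<Rightarrow> point set" where
  "inside_conic G Fs = (\<Union>F\<in>Fs. connected_component_set (- G) F)"

text \<open>Two distinct points of a circle \<open>S\<close> delimit two open arcs: the components of \<open>S\<close> minus
  these points.\<close>

definition infertile_arc :: "point set \<Rightarrow> point set \<Rightarrow> point set \<Rightarrow> point set \<Rightarrow> bool" where
  "infertile_arc S G Fs I \<longleftrightarrow>
     (\<exists>D1 D2. D1 \<noteq> D2 \<and> D1 \<in> S \<inter> G \<and> D2 \<in> S \<inter> G \<and> I \<in> components (S - {D1, D2})) \<and>
     I \<subseteq> inside_conic G Fs"


subsection \<open>The construction\<close>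

text \<open>\<open>S\<close> is the circumcircle, \<open>S\<^sub>D\<close> the negative-pedal circle and \<open>A\<close> the initial point on \<open>S\<close>.
  The circles with diameters \<open>[B'D]\<close> and \<open>[C'D]\<close> pass through \<open>A\<close>, so ``again'' means at a point
  other than \<open>A\<close>. The last condition can only hold if \<open>B \<noteq> C'\<close> and \<open>C \<noteq> B'\<close>, i.e. if
  both lines are defined.\<close>

definition construction ::
  "point \<Rightarrow> point set \<Rightarrow> point set \<Rightarrow> point \<Rightarrow> point \<Rightarrow> point \<Rightarrow> point \<Rightarrow> point \<Rightarrow> point \<Rightarrow> bool" where
  "construction D S S\<^sub>D A B' C' B C A' \<longleftrightarrow>
     B' \<noteq> C' \<and> perpendicular_at D A \<inter> S\<^sub>D = {B', C'} \<and>
     C \<in> circle_with_diameter B' D \<inter> S - {A} \<and>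
     B \<in> circle_with_diameter C' D \<inter> S - {A} \<and>
     line_through B C' \<inter> line_through C B' = {A'}"

definition some_intersection_empty ::
  "point \<Rightarrow> point set \<Rightarrow> point set \<Rightarrow> point \<Rightarrow> bool" where
  "some_intersection_empty D S S\<^sub>D A \<longleftrightarrow>
     perpendicular_at D A \<inter> S\<^sub>D = {} \<or>
     (\<exists>B' C'. perpendicular_at D A \<inter> S\<^sub>D = {B', C'} \<and>
        (circle_with_diameter B' D \<inter> S - {A} = {} \<or>
         circle_with_diameter C' D \<inter> S - {A} = {} \<or>
         (\<exists>C \<in> circle_with_diameter B' D \<inter> S - {A}.
          \<exists>B \<in> circle_with_diameter C' D \<inter> S - {A}.
            line_through B C' \<inter> line_through C B' = {})))"

definition process_stops :: "point \<Rightarrow> point set \<Rightarrow> point set \<Rightarrow> point \<Rightarrow> bool" where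
  "process_stops D S S\<^sub>D A \<longleftrightarrow> (\<nexists>B' C' B C A'. construction D S S\<^sub>D A B' C' B C A')"

end

theory Submission
  imports Defs
begin

text \<open>
  Let \<open>U\<close>, \<open>r\<close> be centre and radius of \<open>S\<close> and \<open>c\<close>, \<open>R\<close> those of \<open>S\<^sub>D\<close>, and let \<open>k\<close> be the power of
  \<open>D\<close> with respect to \<open>S\<close>.

  The first part is a Poncelet theorem. A chord of \<open>S\<^sub>D\<close> on which \<open>D\<close> has its foot on \<open>S\<close> is a chord
  tangent to the conic with foci \<open>D\<close> and \<open>2 U - D\<close> and auxiliary circle \<open>S\<close>; the construction starts
  from such a chord \<open>B'C'\<close> and draws the second tangents from \<open>B'\<close> and \<open>C'\<close>. Normalise \<open>S\<^sub>D\<close> to the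
  complex unit circle and call the foci \<open>f\<close>, \<open>g\<close>. Tangency of the chord \<open>yz\<close> is a symmetric equation,
  quadratic in each end, and Vieta's formula shows that the two tangent chords from \<open>y\<close> end in
  points with product \<open>\<beta> y / y\<close>, where \<open>\<beta>\<close> is the Blaschke product with zeros \<open>0\<close>, \<open>f\<close>, \<open>g\<close>. Applied to
  the given triangle, this yields the relation \<open>(2 r / R)^2 = \<bar>1 - f cnj g\<bar>^2\<close> between the two circles
  (lemma \<open>euler_relation\<close>); given this relation, tangency of a chord \<open>yz\<close> is equivalent to \<open>\<beta> y = \<beta> z\<close>, so the
  second tangents from \<open>y\<close> and from \<open>z\<close> meet on the circle (lemma \<open>poncelet_closure\<close>).

  The second part holds because the circles with diameters \<open>B'D\<close> and \<open>C'D\<close> meet \<open>S\<close> in at most one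
  point besides \<open>A\<close>, so that all choices in the construction
  are forced up to exchanging \<open>B'\<close> and \<open>C'\<close>.

  For infertile arcs, a conic with focus \<open>D\<close> is written \<open>\<bar>X - D\<bar> = \<bar>l + m \<bullet> (X - D)\<bar>\<close>, and the line
  \<open>n \<bullet> (X - D) = 1\<close> is a tangent or an asymptote only if \<open>\<bar>l n + m\<bar> = 1\<close> (lemma \<open>tangent_pole\<close>). The
  side \<open>QR\<close> is such a line with \<open>k n = 2 (U - D) - (P\<^sub>D - D)\<close>, so the tangency conditions say that \<open>P\<^sub>D\<close>,
  \<open>Q\<^sub>D\<close> and \<open>R\<^sub>D\<close> lie on the circle with centre \<open>D + 2 (U - D) + (k / l) m\<close> and radius \<open>\<bar>k / l\<bar>\<close>, which
  is therefore \<open>S\<^sub>D\<close>. For \<open>A\<close> on \<open>S\<close>, the distance from \<open>c\<close> to the perpendicular at \<open>A\<close> then exceeds \<open>R\<close>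
  exactly when \<open>\<bar>A - D\<bar> < \<bar>l + m \<bullet> (A - D)\<bar>\<close>, and this inequality holds inside the conic.
\<close>

section \<open>Perpendiculars, circles and lines in the plane\<close>

lemma line_through_eq_level_set:
  fixes n U V :: point
  assumes "n \<noteq> 0" "U \<noteq> V" "n \<bullet> U = b" "n \<bullet> V = b"
  shows "line_through U V = {X. n \<bullet> X = b}"
proof -
  have "aff_dim {U, V} = DIM(point) - 1" using assms(2) by (simp add: aff_dim_2)
  moreover have "aff_dim {X. n \<bullet> X = b} = DIM(point) - 1"
    using assms(1) by (simp add: aff_dim_hyperplane)
  moreover have "line_through U V \<subseteq> {X. n \<bullet> X = b}"
    using assms(3,4) by (intro hull_minimal) (auto simp: affine_hyperplane)
  ultimately show ?thesis
    by (intro affine_dim_equal) (auto simp: affine_hyperplane)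
qed

lemma perpendicular_at_eq: "perpendicular_at D V = {X. (D - V) \<bullet> X = (D - V) \<bullet> V}"
  by (auto simp: perpendicular_at_def algebra_simps inner_commute)

lemma line_through_eq_perpendicular_at:
  assumes "V \<noteq> D" "X \<noteq> Y" "X \<in> perpendicular_at D V" "Y \<in> perpendicular_at D V"
  shows "line_through X Y = perpendicular_at D V"
  using assms line_through_eq_level_set [of "D - V" X Y "(D - V) \<bullet> V"]
  by (simp add: perpendicular_at_eq)

lemma perpendicular_at_inject:
  assumes "perpendicular_at D V = perpendicular_at D W"
  shows "V = W"
proof -
  have "V \<in> perpendicular_at D V" "W \<in> perpendicular_at D W"
    by (simp_all add: perpendicular_at_def)
  then have "W \<in> perpendicular_at D V" "V \<in> perpendicular_at D W"
    using assms(1) by simp_all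
  then have "(V - W) \<bullet> (V - W) = 0"
    by (simp add: perpendicular_at_def algebra_simps inner_commute)
  then show ?thesis by simp
qed

text \<open>The foot of the perpendicular from \<open>D\<close> to this line is \<open>V\<close>, so passing to the negative pedal
  triangle is inverse to passing to the pedal triangle.\<close>

lemma closest_point_perpendicular_at: "closest_point (perpendicular_at D V) D = V"
proof -
  have "(D - V) \<bullet> (D - V) \<le> (D - X) \<bullet> (D - X)" if "(X - V) \<bullet> (D - V) = 0" for X
  proof -
    have "(D - X) \<bullet> (D - X) = (D - V) \<bullet> (D - V) + (X - V) \<bullet> (X - V)"
      using that by (simp add: algebra_simps inner_commute)
    then show ?thesis by simp
  qed
  then have "\<forall>X \<in> perpendicular_at D V. dist D V \<le> dist D X"
    by (simp add: perpendicular_at_def dist_norm norm_eq_sqrt_inner)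
  moreover have "convex (perpendicular_at D V)" "closed (perpendicular_at D V)"
    unfolding perpendicular_at_eq by (rule convex_hyperplane, rule closed_hyperplane)
  moreover have "V \<in> perpendicular_at D V" by (simp add: perpendicular_at_def)
  ultimately show ?thesis using closest_point_unique by metis
qed

text \<open>Thales: this turns the circles of the construction into right angles at \<open>Z\<close>, the only form in
  which they are used.\<close>

lemma in_circle_with_diameter:
  "Z \<in> circle_with_diameter X D \<longleftrightarrow> X \<in> perpendicular_at D Z"
proof -
  have "Z \<in> circle_with_diameter X D \<longleftrightarrow> norm (X + D - 2 *\<^sub>R Z) = norm (X - D)"
  proof -
    have "norm (midpoint X D - Z) = norm ((1/2) *\<^sub>R (X + D - 2 *\<^sub>R Z))"
      by (simp add: midpoint_def algebra_simps)
    then show ?thesis by (simp add: circle_with_diameter_def dist_norm)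
  qed
  also have "\<dots> \<longleftrightarrow> (X + D - 2 *\<^sub>R Z) \<bullet> (X + D - 2 *\<^sub>R Z) = (X - D) \<bullet> (X - D)"
    by (simp add: norm_eq)
  also have "\<dots> \<longleftrightarrow> 4 * ((X - Z) \<bullet> (D - Z)) = 0"
    by (simp add: algebra_simps inner_commute)
  finally show ?thesis by (simp add: perpendicular_at_def)
qed

text \<open>A point \<open>X + t (Y - X)\<close> of the chord line lies on the circle only if \<open>t (t - 1) = 0\<close>.\<close>

lemma distinct_points_on_circle_triangle:
  assumes "X \<in> sphere c r" "Y \<in> sphere c r" "Z \<in> sphere c r" "X \<noteq> Y" "Y \<noteq> Z" "X \<noteq> Z"
  shows "triangle X Y Z"
proof
  assume "collinear {X, Y, Z}"
  then have "Z \<in> line_through X Y" using assms(4) by (simp add: collinear_3_affine_hull)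
  then obtain t where Z: "Z = X + t *\<^sub>R (Y - X)" by (auto simp: affine_hull_2_alt)
  have "t \<noteq> 0" "t \<noteq> 1" using assms Z by auto
  have 1: "(c - X) \<bullet> (c - X) = (c - Y) \<bullet> (c - Y)" "(c - Z) \<bullet> (c - Z) = (c - X) \<bullet> (c - X)"
    using assms by (auto simp: dist_norm norm_eq [symmetric])
  have "2 * ((c - X) \<bullet> (Y - X)) = (Y - X) \<bullet> (Y - X)"
    using 1(1) by (simp add: algebra_simps inner_commute)
  moreover have "t * (t * ((Y - X) \<bullet> (Y - X)) - 2 * ((c - X) \<bullet> (Y - X))) = 0"
    using 1(2) unfolding Z by (simp add: algebra_simps inner_commute)
  ultimately have "t * (t * ((Y - X) \<bullet> (Y - X)) - (Y - X) \<bullet> (Y - X)) = 0" by simp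
  then have "t * (t - 1) * ((Y - X) \<bullet> (Y - X)) = 0" by auto
  then show False using \<open>t \<noteq> 0\<close> \<open>t \<noteq> 1\<close> assms(4) by simp
qed

lemma triangle_distinct: "triangle X Y Z \<Longrightarrow> X \<noteq> Y \<and> Y \<noteq> Z \<and> Z \<noteq> X"
  by (auto simp: insert_commute)

text \<open>Subtracting the equations of two circles leaves a linear equation whose normal is \<open>c' - c\<close>; if
  it were nonzero, all common points would lie on the radical axis.\<close>

lemma sphere_centre_unique:
  fixes c c' X Y Z :: point
  assumes "triangle X Y Z" "{X, Y, Z} \<subseteq> sphere c r" "{X, Y, Z} \<subseteq> sphere c' r'"
  shows "c = c'"
proof (rule ccontr)
  assume "c \<noteq> c'"
  define b where "b = (c' \<bullet> c' - c \<bullet> c + r^2 - r'^2) / 2"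
  have *: "(c' - c) \<bullet> V = b" if "V \<in> {X, Y, Z}" for V
  proof -
    have "dist c V = r" "dist c' V = r'" using that assms(2,3) by auto
    then have "(c - V) \<bullet> (c - V) = r^2" "(c' - V) \<bullet> (c' - V) = r'^2"
      by (auto simp: dist_norm power2_norm_eq_inner)
    then show ?thesis by (simp add: b_def algebra_simps inner_commute)
  qed
  have "line_through X Y = {V. (c' - c) \<bullet> V = b}"
    using \<open>c \<noteq> c'\<close> triangle_distinct [OF assms(1)]
    by (intro line_through_eq_level_set *) auto
  then have "Z \<in> line_through X Y" using * [of Z] by simp
  then show False using assms(1) triangle_distinct [OF assms(1)] by (simp add: collinear_3_affine_hull)
qed

lemma infdist_level_set:
  fixes n X :: "'a::euclidean_space"
  assumes "n \<noteq> 0"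
  shows "infdist X {Z. n \<bullet> Z = b} = \<bar>n \<bullet> X - b\<bar> / norm n"
proof -
  define W where "W = X - ((n \<bullet> X - b) / (n \<bullet> n)) *\<^sub>R n"
  have W: "n \<bullet> W = b" using assms by (simp add: W_def inner_diff_right)
  have "infdist X {Z. n \<bullet> Z = b} \<le> dist X W" using W by (intro infdist_le) simp
  also have "dist X W = \<bar>n \<bullet> X - b\<bar> / norm n"
    by (simp add: W_def dist_norm dot_square_norm power2_eq_square)
  finally have "infdist X {Z. n \<bullet> Z = b} \<le> \<bar>n \<bullet> X - b\<bar> / norm n" .
  moreover have "\<bar>n \<bullet> X - b\<bar> / norm n \<le> infdist X {Z. n \<bullet> Z = b}"
  proof -
    have "\<bar>n \<bullet> X - b\<bar> / norm n \<le> dist X Z" if "n \<bullet> Z = b" for Z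
      using Cauchy_Schwarz_ineq2 [of n "X - Z"] that assms
      by (simp add: dist_norm inner_diff_right divide_le_eq mult.commute)
    then show ?thesis using W by (auto simp: infdist_def intro!: cINF_greatest)
  qed
  ultimately show ?thesis by simp
qed

section \<open>Chords of the unit circle tangent to a conic with two given foci\<close>

definition right_angle :: "complex \<Rightarrow> complex \<Rightarrow> complex \<Rightarrow> bool" where
  "right_angle y a f \<longleftrightarrow> Re ((y - a) * cnj (f - a)) = 0"

lemma right_angle_iff:
  "right_angle y a f \<longleftrightarrow> (y - a) * (cnj f - cnj a) + (cnj y - cnj a) * (f - a) = 0"
proof -
  define w where "w = (y - a) * cnj (f - a)"
  have "(y - a) * (cnj f - cnj a) + (cnj y - cnj a) * (f - a) = w + cnj w"
    by (simp add: w_def)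
  also have "\<dots> = of_real (2 * Re w)" by (rule complex_add_cnj)
  finally have "(y - a) * (cnj f - cnj a) + (cnj y - cnj a) * (f - a) = 0 \<longleftrightarrow> Re w = 0"
    by (simp del: of_real_mult)
  then show ?thesis unfolding right_angle_def w_def by blast
qed

text \<open>For \<open>y\<close>, \<open>z\<close> on the unit circle, \<open>cnj y = 1 / y\<close>, so the foot of the perpendicular from \<open>f\<close> to
  the chord \<open>yz\<close> is a polynomial in \<open>y\<close>, \<open>z\<close> and \<open>cnj f\<close>.\<close>

lemma chord_foot:
  fixes a f y z :: complex
  assumes "cmod y = 1" "cmod z = 1" "y \<noteq> z" "a \<noteq> f"
    and "right_angle y a f" and "right_angle z a f"
  shows "2 * a = f + y + z - y * z * cnj f"
proof -
  have yz: "y * cnj y = 1" "z * cnj z = 1"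
    using assms(1,2) by (simp_all add: complex_norm_square [symmetric])
  have *: "(y - a) * (cnj f - cnj a) + (cnj y - cnj a) * (f - a) = 0"
          "(z - a) * (cnj f - cnj a) + (cnj z - cnj a) * (f - a) = 0"
    using assms(5,6) by (simp_all add: right_angle_iff)
  have "(y - z) * (y * z * (cnj f - cnj a) - (f - a)) = 0"
    using * yz by algebra
  with assms(3) have 1: "y * z * (cnj f - cnj a) = f - a" by simp
  have "(f - a) * (y + z - a - y * z * cnj a) = 0"
    using * yz 1 by algebra
  with assms(4) have "y + z - a = y * z * cnj a" by simp
  with 1 show ?thesis by (simp add: algebra_simps)
qed

text \<open>The line through \<open>y\<close> on which \<open>f\<close> has the foot \<open>a\<close> meets the unit circle again in \<open>x\<close>. Solving
  the formula of \<open>chord_foot\<close> for \<open>x\<close> covers the tangent case \<open>x = y\<close> as well.\<close>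

lemma second_chord:
  fixes a f y :: complex
  assumes "cmod y = 1" "cmod f \<noteq> 1" "right_angle y a f"
  obtains x where "cmod x = 1" "2 * a = f + y + x - y * x * cnj f" "right_angle x a f"
proof
  define x where "x = (2 * a - f - y) / (1 - y * cnj f)"
  have y: "y * cnj y = 1"
    using assms(1) by (simp add: complex_norm_square [symmetric])
  have "cmod (y * cnj f) \<noteq> 1" using assms(1,2) by (simp add: norm_mult)
  then have nz: "1 - y * cnj f \<noteq> 0" by auto
  then have "cnj (1 - y * cnj f) \<noteq> 0" by (subst complex_cnj_zero_iff)
  have *: "(y - a) * (cnj f - cnj a) + (cnj y - cnj a) * (f - a) = 0"
    using assms(3) by (simp add: right_angle_iff)
  have "(2 * a - f - y) * cnj (2 * a - f - y) = (1 - y * cnj f) * cnj (1 - y * cnj f)"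
    using * y by simp algebra
  then have xx: "x * cnj x = 1" using nz \<open>cnj (1 - y * cnj f) \<noteq> 0\<close>
    by (simp add: x_def)
  then show "cmod x = 1" by (metis complex_mod_sqrt_Re_mult_cnj one_complex.simps(1) real_sqrt_one)
  show 2: "2 * a = f + y + x - y * x * cnj f"
  proof -
    have "x * (1 - y * cnj f) = 2 * a - f - y" using nz by (simp add: x_def)
    then show ?thesis by (simp add: algebra_simps)
  qed
  then have "cnj (2 * a) = cnj (f + y + x - y * x * cnj f)" by simp
  then have 3: "2 * cnj a = cnj f + cnj y + cnj x - cnj y * cnj x * f" by simp
  have "(x - a) * (cnj f - cnj a) + (cnj x - cnj a) * (f - a) = 0"
    using 2 3 y xx by algebra
  then show "right_angle x a f"
    by (simp add: right_angle_iff)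
qed

text \<open>The equation says that the foot of \<open>f\<close> on the chord \<open>yz\<close> of the unit circle lies on the circle
  with centre \<open>(f + g) / 2\<close> and squared radius \<open>\<rho> / 4\<close>; conjugates of \<open>y\<close> and \<open>z\<close> have been
  cleared by multiplying with \<open>y z\<close>. Equivalently, the chord is tangent to the conic with foci
  \<open>f\<close>, \<open>g\<close> and this auxiliary circle.\<close>

definition foot_eq :: "complex \<Rightarrow> complex \<Rightarrow> complex \<Rightarrow> complex \<Rightarrow> complex \<Rightarrow> bool" where
  "foot_eq f g \<rho> y z \<longleftrightarrow>
     (y + z - y * z * cnj f - g) * (y + z - f - y * z * cnj g) = \<rho> * (y * z)"

lemma foot_eq_commute: "foot_eq f g \<rho> y z \<longleftrightarrow> foot_eq f g \<rho> z y"
  by (simp add: foot_eq_def algebra_simps)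

lemma foot_eqI:
  assumes "cmod y = 1" "cmod z = 1" and a: "2 * a = f + y + z - y * z * cnj f"
    and "cmod (2 * a - (f + g)) ^ 2 = r"
  shows "foot_eq f g (of_real r) y z"
proof -
  have yz: "y * cnj y = 1" "z * cnj z = 1"
    using assms(1,2) by (simp_all add: complex_norm_square [symmetric])
  have "(y + z - y * z * cnj f - g) * cnj (y + z - y * z * cnj f - g) = of_real r"
    using assms(4) unfolding a complex_norm_square [symmetric]
    by (simp add: algebra_simps flip: of_real_power)
  moreover have "y * z * cnj (y + z - y * z * cnj f - g) = y + z - f - y * z * cnj g"
    using yz by simp algebra
  ultimately have "(y + z - y * z * cnj f - g) * (y + z - f - y * z * cnj g) = y * z * of_real r"
    by (metis mult.left_commute)
  then show ?thesis unfolding foot_eq_def by (simp only: mult.commute)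
qed

text \<open>For fixed \<open>y\<close> the condition is quadratic in the other end of the chord, and \<open>\<rho>\<close> enters only its
  linear coefficient. Hence the product of the two solutions does not depend on \<open>\<rho>\<close>.\<close>

lemma foot_eq_vieta:
  assumes "foot_eq f g \<rho> y x" "foot_eq f g \<rho> y z" "x \<noteq> z"
  shows "(1 - y * cnj f) * (1 - y * cnj g) * (x * z) = (y - f) * (y - g)"
proof -
  have "(x - z) * ((1 - y * cnj f) * (1 - y * cnj g) * (x * z) - (y - f) * (y - g)) = 0"
    using assms(1,2) unfolding foot_eq_def by algebra
  with assms(3) show ?thesis by simp
qed

text \<open>The Euler--Chapple relation between the two circles. By \<open>foot_eq_vieta\<close> the Blaschke product
  \<open>\<beta> t = t (t - f) (t - g) / ((1 - t cnj f) (1 - t cnj g))\<close> takes the value \<open>x y z\<close> at all three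
  vertices; the equation \<open>\<beta> y = \<beta> z\<close>, divided by \<open>y - z\<close>, is \<open>foot_eq\<close> with the stated \<open>\<rho>\<close>.\<close>

lemma euler_relation:
  assumes "cmod x = 1" "cmod y = 1" "cmod z = 1" "x \<noteq> y" "y \<noteq> z" "z \<noteq> x"
    "foot_eq f g \<rho> x y" "foot_eq f g \<rho> y z" "foot_eq f g \<rho> z x"
  shows "\<rho> = (1 - f * cnj g) * (1 - g * cnj f)"
proof -
  have 1: "(1 - y * cnj f) * (1 - y * cnj g) * (x * z) = (y - f) * (y - g)"
    using foot_eq_vieta [of f g \<rho> y x z] assms foot_eq_commute by blast
  have 2: "(1 - z * cnj f) * (1 - z * cnj g) * (x * y) = (z - f) * (z - g)"
    using foot_eq_vieta [of f g \<rho> z x y] assms foot_eq_commute by blast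
  have "y * z \<noteq> 0" using assms(2,3) by auto
  moreover have "(y - z) * (y * z) * (\<rho> - (1 - f * cnj g) * (1 - g * cnj f)) = 0"
    using 1 2 assms(8) unfolding foot_eq_def by algebra
  ultimately show ?thesis using assms(5) by simp
qed

text \<open>The left-hand side is, up to the factor \<open>- 4\<close>, the power of \<open>f\<close> with respect to the circle of feet,
  so \<open>f\<close> and \<open>g\<close> avoid the unit circle as soon as \<open>f\<close> is not on the circle of feet.\<close>

lemma euler_relation_power:
  assumes "\<rho> = (1 - f * cnj g) * (1 - g * cnj f)"
  shows "\<rho> - of_real (cmod (f - g) ^ 2) = (1 - f * cnj f) * (1 - g * cnj g)"
  unfolding assms complex_norm_square by (simp add: algebra_simps)

text \<open>Poncelet closure for triangles. Given the Euler relation, a chord \<open>yz\<close> tangent to the conic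
  satisfies \<open>\<beta> y = \<beta> z\<close>, with \<open>\<beta>\<close> the Blaschke product. By Vieta the other tangent chord from \<open>y\<close>
  ends in \<open>\<beta> y / (y z)\<close> and the one from \<open>z\<close> in \<open>\<beta> z / (y z)\<close>, hence in the same point.\<close>

lemma poncelet_closure:
  assumes "cmod y = 1" "cmod z = 1" "y \<noteq> z"
    and yz: "foot_eq f g \<rho> y z" and "foot_eq f g \<rho> y x" and "foot_eq f g \<rho> z x'"
    and "x \<noteq> z" "x' \<noteq> y"
    and \<rho>: "\<rho> = (1 - f * cnj g) * (1 - g * cnj f)" and "\<rho> \<noteq> of_real (cmod (f - g) ^ 2)"
  shows "x = x'"
proof -
  have unit: "y * cnj y = 1" "z * cnj z = 1"
    using assms(1,2) by (simp_all add: complex_norm_square [symmetric])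
  have 1: "(1 - y * cnj f) * (1 - y * cnj g) * (x * z) = (y - f) * (y - g)"
    using foot_eq_vieta [of f g \<rho> y x z] assms by blast
  have 2: "(1 - z * cnj f) * (1 - z * cnj g) * (x' * y) = (z - f) * (z - g)"
    using foot_eq_vieta [of f g \<rho> z x' y] assms foot_eq_commute by blast
  from euler_relation_power [OF \<rho>] assms(10) have fg: "1 - f * cnj f \<noteq> 0" "1 - g * cnj g \<noteq> 0" by auto
  have nz: "1 - t * cnj h \<noteq> 0" if "t * cnj t = 1" "1 - h * cnj h \<noteq> 0" for t h
  proof
    assume "1 - t * cnj h = 0"
    moreover then have "1 - cnj t * h = 0"
      by (metis complex_cnj_cnj complex_cnj_diff complex_cnj_mult complex_cnj_one complex_cnj_zero)
    ultimately have "1 - h * cnj h = 0" using that(1) by algebra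
    with that(2) show False by simp
  qed
  have "y * (y - f) * (y - g) * ((1 - z * cnj f) * (1 - z * cnj g))
      = z * (z - f) * (z - g) * ((1 - y * cnj f) * (1 - y * cnj g))"
    using yz unfolding foot_eq_def \<rho> by algebra
  with 1 2 have "(y * z) * ((1 - y * cnj f) * (1 - y * cnj g)) * ((1 - z * cnj f) * (1 - z * cnj g)) * (x - x') = 0"
    by algebra
  moreover have "y * z \<noteq> 0" using assms(1,2) by auto
  ultimately show ?thesis using nz unit fg by simp
qed

section \<open>Closure of the construction\<close>

text \<open>The similarity that carries the circle with centre \<open>c\<close> and radius \<open>R\<close> to the unit circle.\<close>

definition chart :: "point \<Rightarrow> real \<Rightarrow> point \<Rightarrow> complex" where
  "chart c R X = Complex ((X $ 1 - c $ 1) / R) ((X $ 2 - c $ 2) / R)"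

lemma chart_inner:
  assumes "R \<noteq> 0"
  shows "(X - V) \<bullet> (W - V) =
    R^2 * Re ((chart c R X - chart c R V) * cnj (chart c R W - chart c R V))"
  using assms by (simp add: chart_def inner_vec_def sum_2 field_simps power2_eq_square)

lemma cmod_chart_diff:
  assumes "R > 0"
  shows "cmod (chart c R X - chart c R Y) = dist X Y / R"
proof -
  define w where "w = chart c R X - chart c R Y"
  have "(dist X Y)^2 = R^2 * Re (w * cnj w)"
    using chart_inner [of R X Y X c] assms by (simp add: dist_norm power2_norm_eq_inner w_def)
  also have "Re (w * cnj w) = cmod w ^ 2" unfolding complex_norm_square [symmetric] by simp
  finally have "(dist X Y)^2 = (R * cmod (chart c R X - chart c R Y))^2"
    by (simp add: w_def power_mult_distrib)
  then have "dist X Y = R * cmod (chart c R X - chart c R Y)"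
    using assms by (simp add: power2_eq_iff_nonneg)
  then show ?thesis using assms by simp
qed

lemma chart_centre [simp]: "chart c R c = 0"
  by (simp add: chart_def Complex_eq_0)

lemma chart_on_circle:
  assumes "R > 0"
  shows "cmod (chart c R X) = 1 \<longleftrightarrow> X \<in> sphere c R"
  using cmod_chart_diff [OF assms, of c X c] assms by (auto simp: dist_commute)

lemma chart_eq_iff: "R > 0 \<Longrightarrow> chart c R X = chart c R Y \<longleftrightarrow> X = Y"
  using cmod_chart_diff [of R c X Y] by auto

lemma chart_surj:
  assumes "R > 0"
  obtains X where "chart c R X = w"
proof
  show "chart c R (vector [c $ 1 + R * Re w, c $ 2 + R * Im w]) = w"
    using assms by (simp add: chart_def)
qed

lemma chart_perpendicular_at:
  assumes "R > 0"
  shows "X \<in> perpendicular_at D V \<longleftrightarrow> right_angle (chart c R X) (chart c R V) (chart c R D)"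
  unfolding perpendicular_at_def right_angle_def using assms chart_inner [of R X V D c] by simp

lemma chart_foot_eq:
  assumes "R > 0" "A \<in> sphere U r" "cmod y = 1" "cmod z = 1"
    and "2 * chart c R A = chart c R D + y + z - y * z * cnj (chart c R D)"
  shows "foot_eq (chart c R D) (2 * chart c R U - chart c R D) (of_real ((2 * r / R)^2)) y z"
proof (rule foot_eqI [OF assms(3-5)])
  have "2 * chart c R A - (chart c R D + (2 * chart c R U - chart c R D))
      = 2 * (chart c R A - chart c R U)" by simp
  then have "cmod (2 * chart c R A - (chart c R D + (2 * chart c R U - chart c R D))) =
    2 * (dist A U / R)"
    using cmod_chart_diff [OF assms(1), of c A U] by (simp only: norm_mult) simp
  moreover have "dist A U = r" using assms(2) by (simp add: dist_commute)
  ultimately show "(cmod (2 * chart c R A - (chart c R D + (2 * chart c R U - chart c R D))))^2 =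
    (2 * r / R)^2"
    by (metis times_divide_eq_right)
qed

text \<open>The vertices \<open>P\<close>, \<open>Q\<close>, \<open>T\<close> are the feet of \<open>D\<close> on the sides of \<open>P'Q'T'\<close>. The second focus \<open>g\<close>
  is the reflection of \<open>D\<close> in the centre of the pedal circle.\<close>

lemma inscribed_triangle_euler_relation:
  assumes "R > 0" "D \<notin> sphere U r" "{P, Q, T} \<subseteq> sphere U r"
    and "triangle P' Q' T'" "{P', Q', T'} \<subseteq> sphere c R"
    and "{Q', T'} \<subseteq> perpendicular_at D P" "{T', P'} \<subseteq> perpendicular_at D Q"
      "{P', Q'} \<subseteq> perpendicular_at D T"
    and f: "f = chart c R D" and g: "g = 2 * chart c R U - chart c R D"
  shows "of_real ((2 * r / R)^2) = (1 - f * cnj g) * (1 - g * cnj f)"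
proof -
  have foot: "foot_eq f g (of_real ((2 * r / R)^2)) (chart c R Y) (chart c R Z)"
    if "A \<in> sphere U r" "{Y, Z} \<subseteq> perpendicular_at D A" "{Y, Z} \<subseteq> sphere c R" "Y \<noteq> Z" for A Y Z
  proof -
    have "A \<noteq> D" using that(1) assms(2) by auto
    then have ne: "chart c R A \<noteq> f" "chart c R Y \<noteq> chart c R Z"
      using that(4) assms(1) by (simp_all add: f chart_eq_iff)
    have unit: "cmod (chart c R Y) = 1" "cmod (chart c R Z) = 1"
      using that(3) chart_on_circle [OF assms(1)] by blast+
    have perp: "right_angle (chart c R Y) (chart c R A) f" "right_angle (chart c R Z) (chart c R A) f"
      using that(2) chart_perpendicular_at [OF assms(1), of _ D A c] unfolding f by blast+
    from chord_foot [OF unit ne(2,1) perp] show ?thesis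
      using chart_foot_eq [OF assms(1) that(1) unit] unfolding f g by blast
  qed
  note d = triangle_distinct [OF assms(4)]
  have "foot_eq f g (of_real ((2 * r / R)^2)) (chart c R P') (chart c R Q')"
    by (rule foot [of T]) (use assms(3,5-8) d in simp_all)
  moreover have "foot_eq f g (of_real ((2 * r / R)^2)) (chart c R Q') (chart c R T')"
    by (rule foot [of P]) (use assms(3,5-8) d in simp_all)
  moreover have "foot_eq f g (of_real ((2 * r / R)^2)) (chart c R T') (chart c R P')"
    by (rule foot [of Q]) (use assms(3,5-8) d in simp_all)
  moreover have "chart c R P' \<noteq> chart c R Q'" "chart c R Q' \<noteq> chart c R T'" "chart c R T' \<noteq> chart c R P'"
    using d assms(1) by (simp_all add: chart_eq_iff)
  moreover have "cmod (chart c R P') = 1" "cmod (chart c R Q') = 1" "cmod (chart c R T') = 1"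
    using assms(1,5) by (simp_all add: chart_on_circle)
  ultimately show ?thesis by (intro euler_relation)
qed

text \<open>The perpendiculars at \<open>B\<close> and \<open>C\<close> are the second tangents from \<open>C'\<close> and \<open>B'\<close> to the conic;
  \<open>poncelet_closure\<close> lets them meet on the circle through \<open>B'\<close> and \<open>C'\<close>. The conditions
  \<open>B \<noteq> A\<close> and \<open>C \<noteq> A\<close> say that they really are the second tangents.\<close>

lemma third_vertex_on_circle:
  assumes "R > 0" "D \<notin> sphere U r" "{A, B, C} \<subseteq> sphere U r" "{B', C'} \<subseteq> sphere c R"
    and "B' \<noteq> C'" "B \<noteq> A" "C \<noteq> A"
    and "{B', C'} \<subseteq> perpendicular_at D A"
      "C' \<in> perpendicular_at D B" "B' \<in> perpendicular_at D C"
    and f: "f = chart c R D" and g: "g = 2 * chart c R U - chart c R D"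
    and \<rho>: "of_real ((2 * r / R)^2) = (1 - f * cnj g) * (1 - g * cnj f)"
    and "r > 0"
  obtains X where "X \<in> sphere c R" "X \<in> perpendicular_at D B" "X \<in> perpendicular_at D C"
proof -
  let ?\<phi> = "chart c R" and ?\<rho> = "complex_of_real ((2 * r / R)^2)"
  have unit: "cmod (?\<phi> B') = 1" "cmod (?\<phi> C') = 1"
    using assms(1,4) by (simp_all add: chart_on_circle)
  have ne: "?\<phi> B' \<noteq> ?\<phi> C'" "?\<phi> A \<noteq> f"
    using assms(1-3,5) by (auto simp: f chart_eq_iff)
  have perp: "right_angle (?\<phi> B') (?\<phi> A) f" "right_angle (?\<phi> C') (?\<phi> A) f"
    "right_angle (?\<phi> B') (?\<phi> C) f" "right_angle (?\<phi> C') (?\<phi> B) f"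
    using assms(8-10) chart_perpendicular_at [OF assms(1)] unfolding f by blast+
  have "cmod (f - g) \<noteq> 2 * r / R"
  proof
    have "f - g = 2 * (?\<phi> D - ?\<phi> U)" by (simp add: f g)
    then have "cmod (f - g) = 2 * (dist D U / R)"
      using cmod_chart_diff [OF assms(1), of c D U] by (simp only: norm_mult) simp
    moreover assume "cmod (f - g) = 2 * r / R"
    ultimately show False using assms(1,2) by (simp add: dist_commute)
  qed
  then have "(2 * r / R)^2 \<noteq> cmod (f - g)^2"
    using assms(1) \<open>r > 0\<close> by (auto simp: power2_eq_iff_nonneg)
  then have \<rho>': "?\<rho> \<noteq> of_real (cmod (f - g) ^ 2)" by (simp del: of_real_power)
  have "cmod f \<noteq> 1"
  proof
    assume "cmod f = 1"
    then have "f * cnj f = 1" by (simp add: complex_norm_square [symmetric])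
    then show False using euler_relation_power [OF \<rho>] \<rho>' by simp
  qed
  have a: "2 * ?\<phi> A = f + ?\<phi> B' + ?\<phi> C' - ?\<phi> B' * ?\<phi> C' * cnj f"
    using chord_foot [OF unit ne perp(1,2)] .
  obtain x where x: "cmod x = 1" "2 * ?\<phi> C = f + ?\<phi> B' + x - ?\<phi> B' * x * cnj f"
      "right_angle x (?\<phi> C) f"
    using second_chord [OF unit(1) \<open>cmod f \<noteq> 1\<close> perp(3)] .
  obtain x' where x': "cmod x' = 1" "2 * ?\<phi> B = f + ?\<phi> C' + x' - ?\<phi> C' * x' * cnj f"
      "right_angle x' (?\<phi> B) f"
    using second_chord [OF unit(2) \<open>cmod f \<noteq> 1\<close> perp(4)] .
  have "x \<noteq> ?\<phi> C'"
  proof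
    assume "x = ?\<phi> C'"
    then have "2 * ?\<phi> C = 2 * ?\<phi> A" using a x(2) by simp
    then show False using assms(1) \<open>C \<noteq> A\<close> by (simp add: chart_eq_iff)
  qed
  have "x' \<noteq> ?\<phi> B'"
  proof
    assume "x' = ?\<phi> B'"
    then have "2 * ?\<phi> B = 2 * ?\<phi> A" using a x'(2) by (simp add: ac_simps)
    then show False using assms(1) \<open>B \<noteq> A\<close> by (simp add: chart_eq_iff)
  qed
  have "foot_eq f g ?\<rho> (?\<phi> B') (?\<phi> C')"
    unfolding f g by (rule chart_foot_eq) (use assms(1,3) unit a in \<open>simp_all add: f\<close>)
  moreover have "foot_eq f g ?\<rho> (?\<phi> B') x"
    unfolding f g by (rule chart_foot_eq) (use assms(1,3) unit x(1,2) in \<open>simp_all add: f\<close>)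
  moreover have "foot_eq f g ?\<rho> (?\<phi> C') x'"
    unfolding f g by (rule chart_foot_eq) (use assms(1,3) unit x'(1,2) in \<open>simp_all add: f\<close>)
  ultimately have "x = x'"
    using poncelet_closure [OF unit ne(1)] \<open>x \<noteq> ?\<phi> C'\<close> \<open>x' \<noteq> ?\<phi> B'\<close> \<rho> \<rho>' by blast
  obtain X where "?\<phi> X = x" using chart_surj [OF assms(1)] .
  then have "X \<in> sphere c R" "X \<in> perpendicular_at D B" "X \<in> perpendicular_at D C"
    using x(1,3) x'(3) \<open>x = x'\<close>
    by (simp_all only: chart_on_circle [OF assms(1), symmetric]
        chart_perpendicular_at [OF assms(1), of _ D _ c] f)
  then show thesis by (rule that)
qed

text \<open>Apart from \<open>third_vertex_on_circle\<close> this excludes the degenerate positions: any coincidence among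
  the points would force two of the perpendiculars at \<open>A\<close>, \<open>B\<close>, \<open>C\<close> to be equal, hence two of
  the feet to be equal, or would contradict the lines meeting in exactly one point.\<close>

lemma construction_closes:
  assumes "S = sphere U r" "S\<^sub>D = sphere c R" "r > 0" "R > 0" "D \<notin> S" "A \<in> S"
    and f: "f = chart c R D" and g: "g = 2 * chart c R U - chart c R D"
    and \<rho>: "of_real ((2 * r / R)^2) = (1 - f * cnj g) * (1 - g * cnj f)"
    and con: "construction D S S\<^sub>D A B' C' B C A'"
  shows "negative_pedal_triangle D A B C A' B' C' \<and> A' \<in> S\<^sub>D \<and> {B, C} \<subseteq> S"
proof -
  have perpA: "B' \<noteq> C'" "B' \<in> S\<^sub>D" "C' \<in> S\<^sub>D" "B' \<in> perpendicular_at D A" "C' \<in> perpendicular_at D A"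
    using con by (auto simp: construction_def)
  have BC: "B \<in> S" "B \<noteq> A" "C' \<in> perpendicular_at D B" "C \<in> S" "C \<noteq> A" "B' \<in> perpendicular_at D C"
    using con by (auto simp: construction_def in_circle_with_diameter)
  have A': "line_through B C' \<inter> line_through C B' = {A'}"
    using con by (simp add: construction_def)
  have "A \<noteq> D" "B \<noteq> D" "C \<noteq> D" using assms(5,6) BC by auto
  have own: "V \<in> perpendicular_at D V" for V by (simp add: perpendicular_at_def)
  have lineA: "line_through B' C' = perpendicular_at D A"
    using line_through_eq_perpendicular_at perpA \<open>A \<noteq> D\<close> by blast
  have lineB: "line_through B C' = perpendicular_at D B" if "B \<noteq> C'"
    using line_through_eq_perpendicular_at BC(3) \<open>B \<noteq> D\<close> own that by blast
  have lineC: "line_through C B' = perpendicular_at D C" if "C \<noteq> B'"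
    using line_through_eq_perpendicular_at BC(6) \<open>C \<noteq> D\<close> own that by blast
  have notboth: "\<not> (C' \<in> perpendicular_at D C)"
  proof
    assume "C' \<in> perpendicular_at D C"
    then have "line_through B' C' = perpendicular_at D C"
      using line_through_eq_perpendicular_at BC(6) \<open>C \<noteq> D\<close> perpA(1) by blast
    then show False using lineA perpendicular_at_inject BC(5) by metis
  qed
  have notboth': "\<not> (B' \<in> perpendicular_at D B)"
  proof
    assume "B' \<in> perpendicular_at D B"
    then have "line_through B' C' = perpendicular_at D B"
      using line_through_eq_perpendicular_at BC(3) \<open>B \<noteq> D\<close> perpA(1) by blast
    then show False using lineA perpendicular_at_inject BC(2) by metis
  qed
  have "B \<noteq> C'"
  proof
    assume "B = C'"
    then have "{C'} \<inter> line_through C B' = {A'}" using A' by simp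
    then have *: "C' \<in> line_through C B'" by (metis IntD1 IntD2 insertI1 singletonD)
    then have "C \<noteq> B'" using perpA(1) by auto
    then show False using lineC notboth * by metis
  qed
  have "C \<noteq> B'"
  proof
    assume "C = B'"
    then have "line_through B C' \<inter> {B'} = {A'}" using A' by simp
    then have "B' \<in> line_through B C'" by (metis IntD1 IntD2 insertI1 singletonD)
    then show False using lineB notboth' \<open>B \<noteq> C'\<close> by metis
  qed
  have single: "perpendicular_at D B \<inter> perpendicular_at D C = {A'}"
    using A' lineB lineC \<open>B \<noteq> C'\<close> \<open>C \<noteq> B'\<close> by simp
  then have "B \<noteq> C" using own notboth BC(3) by auto
  obtain X where "X \<in> sphere c R" "X \<in> perpendicular_at D B" "X \<in> perpendicular_at D C"
    by (rule third_vertex_on_circle [of R D U r A B C B' C' c f g])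
      (use assms perpA BC in auto)
  then have "A' \<in> S\<^sub>D" using single assms(2) by auto
  have "A' \<noteq> B'" "A' \<noteq> C'" using single notboth notboth' by auto
  have "triangle A B C"
    using distinct_points_on_circle_triangle [of A U r B C] assms(1,6) BC \<open>B \<noteq> C\<close> by auto
  moreover have "triangle A' B' C'"
    using distinct_points_on_circle_triangle [of A' c R B' C'] assms(2) perpA \<open>A' \<in> S\<^sub>D\<close> \<open>A' \<noteq> B'\<close> \<open>A' \<noteq> C'\<close> by auto
  moreover have "line_through C' A' = perpendicular_at D B" "line_through A' B' = perpendicular_at D C"
    using line_through_eq_perpendicular_at [OF \<open>B \<noteq> D\<close> \<open>A' \<noteq> C'\<close> [symmetric] BC(3)]
      line_through_eq_perpendicular_at [OF \<open>C \<noteq> D\<close> \<open>A' \<noteq> B'\<close> _ BC(6)] single by auto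
  ultimately show ?thesis
    using lineA \<open>A' \<in> S\<^sub>D\<close> BC by (simp add: negative_pedal_triangle_def)
qed

lemma negative_pedal_imp_pedal:
  assumes "negative_pedal_triangle D X Y Z X' Y' Z'"
  shows "pedal_triangle D X' Y' Z' X Y Z"
  using assms by (simp add: negative_pedal_triangle_def pedal_triangle_def closest_point_perpendicular_at)

lemma negative_pedal_incident:
  assumes "negative_pedal_triangle D X Y Z X' Y' Z'"
  shows "{Y', Z'} \<subseteq> perpendicular_at D X" "{Z', X'} \<subseteq> perpendicular_at D Y" "{X', Y'} \<subseteq> perpendicular_at D Z"
proof -
  have "{U, V} \<subseteq> line_through U V" for U V :: point by (rule hull_subset)
  then show "{Y', Z'} \<subseteq> perpendicular_at D X" "{Z', X'} \<subseteq> perpendicular_at D Y"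
    "{X', Y'} \<subseteq> perpendicular_at D Z"
    using assms unfolding negative_pedal_triangle_def by metis+
qed

lemma circumcircle_as_sphere:
  assumes "circumcircle_of S X Y Z"
  obtains c r where "S = sphere c r" "r > 0"
proof -
  obtain c r where S: "S = sphere c r" "X \<in> S" "Y \<in> S" "X \<noteq> Y"
    using assms triangle_distinct by (auto simp: circumcircle_of_def)
  then have "r \<ge> 0" "r \<noteq> 0" by auto
  then show thesis using that S(1) by force
qed

section \<open>Conics with a given focus\<close>

text \<open>The focus-directrix equation \<open>dist X D = \<bar>l + m \<bullet> (X - D)\<bar>\<close>, squared. With \<open>l \<noteq> 0\<close> it describes
  ellipses, parabolas and both branches of hyperbolas with focus \<open>D\<close> alike.\<close>

definition focal_conic :: "point \<Rightarrow> real \<Rightarrow> point \<Rightarrow> point set" where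
  "focal_conic D l m = {X. (dist X D)^2 = (l + m \<bullet> (X - D))^2}"

definition focal_interior :: "point \<Rightarrow> real \<Rightarrow> point \<Rightarrow> point set" where
  "focal_interior D l m = {X. (dist X D)^2 < (l + m \<bullet> (X - D))^2}"

text \<open>With \<open>x = dist X D\<close> and \<open>y = dist X F\<close>, the law of cosines gives
  \<open>l + m \<bullet> (X - D) = (s^2 + x^2 - y^2) / (2 s)\<close>, and \<open>(s^2 + x^2 - y^2)^2 - (2 s x)^2\<close> splits into
  linear factors. Which of them can vanish depends on the sign of \<open>s - dist D F\<close>: this separates
  ellipses from hyperbolas.\<close>

lemma bifocal_identity:
  fixes D F X :: point
  assumes "s > 0" and l: "l = (s^2 - (dist D F)^2) / (2 * s)" and m: "m = (1 / s) *\<^sub>R (F - D)"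
  shows "4 * s^2 * ((l + m \<bullet> (X - D))^2 - (dist X D)^2) =
    (s + dist X D - dist X F) * (s + dist X D + dist X F) *
    (s - dist X D - dist X F) * (s - dist X D + dist X F)"
proof -
  define x y where "x = dist X D" and "y = dist X F"
  have "y^2 = x^2 - 2 * ((F - D) \<bullet> (X - D)) + (dist D F)^2"
    by (simp add: x_def y_def dist_norm power2_norm_eq_inner algebra_simps inner_commute)
  moreover have "(F - D) \<bullet> (X - D) = s * (m \<bullet> (X - D))" "2 * s * l = s^2 - (dist D F)^2"
    using assms(1) by (simp_all add: l m)
  ultimately have "2 * s * (l + m \<bullet> (X - D)) = s^2 + x^2 - y^2"
    by (simp add: distrib_left)
  then have "4 * s^2 * (l + m \<bullet> (X - D))^2 = (s^2 + x^2 - y^2)^2"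
    by (metis (no_types, opaque_lifting) power_mult_distrib power2_eq_square mult_2 numeral_Bit0 numeral_One)
  then show ?thesis
    unfolding x_def [symmetric] y_def [symmetric] by (simp add: algebra_simps power2_eq_square)
qed

lemma bifocal_conic:
  fixes D F :: point
  assumes "s > 0" "s \<noteq> dist D F"
  obtains l m where "l \<noteq> 0"
    "\<And>X. X \<in> focal_conic D l m \<longleftrightarrow>
      (s + dist X D - dist X F) * (s - dist X D - dist X F) * (s - dist X D + dist X F) = 0"
    "D \<in> focal_interior D l m" "F \<in> focal_interior D l m"
proof -
  define l where "l = (s^2 - (dist D F)^2) / (2 * s)"
  define m where "m = (1 / s) *\<^sub>R (F - D)"
  note id = bifocal_identity [OF assms(1) l_def m_def]
  have sq: "(dist D F)^2 \<noteq> s^2" using assms by (simp add: power2_eq_iff_nonneg)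
  then have "l \<noteq> 0" using assms(1) by (simp add: l_def)
  moreover have "X \<in> focal_conic D l m \<longleftrightarrow>
      (s + dist X D - dist X F) * (s - dist X D - dist X F) * (s - dist X D + dist X F) = 0" for X
  proof -
    have "X \<in> focal_conic D l m \<longleftrightarrow> 4 * s^2 * ((l + m \<bullet> (X - D))^2 - (dist X D)^2) = 0"
      using assms(1) by (auto simp: focal_conic_def)
    also have "\<dots> \<longleftrightarrow>
      (s + dist X D - dist X F) * (s - dist X D - dist X F) * (s - dist X D + dist X F) = 0"
    proof -
      have "s + dist X D + dist X F \<noteq> 0"
        using assms(1) zero_le_dist [of X D] zero_le_dist [of X F] by linarith
      then show ?thesis unfolding id by (simp only: mult_eq_0_iff) blast
    qed
    finally show ?thesis .
  qed
  moreover have "D \<in> focal_interior D l m" using \<open>l \<noteq> 0\<close> by (simp add: focal_interior_def)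
  moreover have "F \<in> focal_interior D l m"
  proof -
    have "4 * s^2 * ((l + m \<bullet> (F - D))^2 - (dist F D)^2) = (s^2 - (dist D F)^2)^2"
      unfolding id by (simp add: power2_eq_square algebra_simps dist_commute)
    also have "\<dots> > 0" using sq by simp
    finally show ?thesis using assms(1) by (simp add: focal_interior_def zero_less_mult_iff)
  qed
  ultimately show thesis by (rule that)
qed

lemma line_through_level_set_exists:
  fixes U V :: point
  assumes "U \<noteq> V"
  obtains n b where "n \<noteq> 0" "line_through U V = {X. n \<bullet> X = b}"
proof -
  obtain n where n: "n \<noteq> 0" "orthogonal (U - V) n"
    using orthogonal_to_vector_exists [of "U - V"] by auto
  then have "n \<bullet> U = n \<bullet> V" by (simp add: orthogonal_def inner_diff_left inner_commute [of n])
  then show thesis using that n line_through_eq_level_set [OF n(1) assms] by metis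
qed

lemma conic_focal_form:
  assumes "conic_with_foci G Fs" "D \<in> Fs"
  obtains l m where "l \<noteq> 0" "G = focal_conic D l m" "Fs \<subseteq> focal_interior D l m"
proof -
  note goal = that
  have two: thesis if "s > 0" "s \<noteq> dist D F" "Fs = {D, F}"
    "\<And>X. X \<in> G \<longleftrightarrow> (s + dist X D - dist X F) * (s - dist X D - dist X F) * (s - dist X D + dist X F) = 0"
    for s F
  proof (rule bifocal_conic [OF that(1,2)])
    fix l m
    assume *: "l \<noteq> 0" "D \<in> focal_interior D l m" "F \<in> focal_interior D l m"
      and "\<And>X. X \<in> focal_conic D l m \<longleftrightarrow>
        (s + dist X D - dist X F) * (s - dist X D - dist X F) * (s - dist X D + dist X F) = 0"
    then have "G = focal_conic D l m" using that(4) by blast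
    then show thesis using goal * that(3) by simp
  qed
  from assms(1) consider
    (ellipse) F1 F2 a where "dist F1 F2 < 2 * a" "G = {X. dist X F1 + dist X F2 = 2 * a}" "Fs = {F1, F2}"
  | (hyperbola) F1 F2 a where "0 < a" "2 * a < dist F1 F2"
      "G = {X. \<bar>dist X F1 - dist X F2\<bar> = 2 * a}" "Fs = {F1, F2}"
  | (parabola) F U V where "U \<noteq> V" "F \<notin> line_through U V"
      "G = {X. dist X F = infdist X (line_through U V)}" "Fs = {F}"
    unfolding conic_with_foci_def by blast
  then show thesis
  proof cases
    case ellipse
    have "\<exists>F. Fs = {D, F} \<and> dist D F < 2 * a \<and> G = {X. dist X D + dist X F = 2 * a}"
    proof (cases "D = F1")
      case False
      then have "D = F2" using assms(2) ellipse(3) by simp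
      then show ?thesis using ellipse by (intro exI [of _ F1]) (auto simp: dist_commute add.commute)
    qed (use ellipse in auto)
    then obtain F where F: "Fs = {D, F}" "dist D F < 2 * a" "G = {X. dist X D + dist X F = 2 * a}"
      by blast
    show thesis
    proof (rule two [of "2 * a" F])
      show "2 * a > 0" using F(2) zero_le_dist [of D F] by linarith
      show "X \<in> G \<longleftrightarrow> (2 * a + dist X D - dist X F) * (2 * a - dist X D - dist X F) *
          (2 * a - dist X D + dist X F) = 0" for X
      proof -
        have "2 * a + dist X D - dist X F \<noteq> 0" "2 * a - dist X D + dist X F \<noteq> 0"
          using F(2) dist_triangle [of X F D] dist_triangle [of X D F] by (auto simp: dist_commute)
        then show ?thesis unfolding F(3) by auto
      qed
    qed (use F in auto)
  next
    case hyperbola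
    have "\<exists>F. Fs = {D, F} \<and> 2 * a < dist D F \<and> G = {X. \<bar>dist X D - dist X F\<bar> = 2 * a}"
    proof (cases "D = F1")
      case False
      then have "D = F2" using assms(2) hyperbola(4) by simp
      then show ?thesis using hyperbola
        by (intro exI [of _ F1]) (auto simp: dist_commute abs_minus_commute)
    qed (use hyperbola in auto)
    then obtain F where F: "Fs = {D, F}" "2 * a < dist D F" "G = {X. \<bar>dist X D - dist X F\<bar> = 2 * a}"
      by blast
    show thesis
    proof (rule two [of "2 * a" F])
      show "X \<in> G \<longleftrightarrow> (2 * a + dist X D - dist X F) * (2 * a - dist X D - dist X F) *
          (2 * a - dist X D + dist X F) = 0" for X
      proof -
        have "2 * a - dist X D - dist X F \<noteq> 0"
          using F(2) dist_triangle3 [of D F X] by auto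
        then show ?thesis unfolding F(3) using hyperbola(1) by (auto simp: abs_if)
      qed
    qed (use F hyperbola in auto)
  next
    case parabola
    then have D: "F = D" using assms(2) by simp
    obtain n b where n: "n \<noteq> 0" "line_through U V = {X. n \<bullet> X = b}"
      using line_through_level_set_exists [OF parabola(1)] .
    define l where "l = (n \<bullet> D - b) / norm n"
    define m where "m = (1 / norm n) *\<^sub>R n"
    have "l \<noteq> 0" using parabola(2) n D by (simp add: l_def)
    have "infdist X (line_through U V) = \<bar>l + m \<bullet> (X - D)\<bar>" for X
    proof -
      have "l + m \<bullet> (X - D) = (n \<bullet> X - b) / norm n"
        using n(1) by (simp add: l_def m_def inner_diff_right field_simps)
      then show ?thesis unfolding n(2) infdist_level_set [OF n(1)] by simp
    qed
    then have "dist X D = infdist X (line_through U V) \<longleftrightarrow> (dist X D)^2 = (l + m \<bullet> (X - D))^2" for X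
      using zero_le_dist [of X D] by (simp only: power2_eq_iff) linarith
    then have "G = focal_conic D l m"
      unfolding parabola(3) D focal_conic_def by simp
    moreover note \<open>l \<noteq> 0\<close>
    moreover have "Fs \<subseteq> focal_interior D l m"
      using \<open>l \<noteq> 0\<close> parabola(4) D by (simp add: focal_interior_def)
    ultimately show thesis by (intro goal)
  qed
qed

text \<open>The difference of the two sides of the equation of the conic has no zero off the conic, hence a
  constant sign on the component of each focus, and it is negative at the foci.\<close>

lemma inside_conic_subset_focal_interior:
  assumes "Fs \<subseteq> focal_interior D l m"
  shows "inside_conic (focal_conic D l m) Fs \<subseteq> focal_interior D l m"
proof
  fix A assume "A \<in> inside_conic (focal_conic D l m) Fs"
  then obtain F where F: "F \<in> Fs" "A \<in> connected_component_set (- focal_conic D l m) F"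
    by (auto simp: inside_conic_def)
  define C where "C = connected_component_set (- focal_conic D l m) F"
  define h where "h X = (dist X D)^2 - (l + m \<bullet> (X - D))^2" for X
  have "C \<subseteq> - focal_conic D l m" unfolding C_def by (rule connected_component_subset)
  then have "0 \<notin> h ` C" by (auto simp: h_def focal_conic_def)
  have "connected (h ` C)" unfolding h_def C_def
    by (intro connected_continuous_image continuous_intros connected_connected_component)
  moreover have "h F < 0" using F(1) assms by (auto simp: h_def focal_interior_def)
  moreover have "F \<in> C" "A \<in> C" using F(2) connected_component_in(1) [of _ F A]
    unfolding C_def by auto
  ultimately have "h A < 0"
    using \<open>0 \<notin> h ` C\<close> connectedD_interval [of "h ` C" "h F" "h A" 0] by force
  then show "A \<in> focal_interior D l m" by (simp add: h_def focal_interior_def)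
qed

text \<open>Polar coordinates around the focus, with signed radius.\<close>

lemma focal_conic_polar:
  assumes "l \<noteq> 0"
  shows "X \<in> focal_conic D l m \<longleftrightarrow>
    (\<exists>u. norm u = 1 \<and> m \<bullet> u \<noteq> 1 \<and> X = D + (l / (1 - m \<bullet> u)) *\<^sub>R u)"
proof
  assume X: "X \<in> focal_conic D l m"
  define s where "s = l + m \<bullet> (X - D)"
  define u where "u = (1 / s) *\<^sub>R (X - D)"
  have "norm (X - D) ^ 2 = s^2" using X by (simp add: focal_conic_def s_def dist_norm)
  then have *: "norm (X - D) = \<bar>s\<bar>" by (metis abs_norm_cancel power2_eq_iff abs_eq_iff)
  have "s \<noteq> 0"
  proof
    assume "s = 0"
    then have "X = D" using * by simp
    then show False using \<open>s = 0\<close> assms by (simp add: s_def)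
  qed
  then have "norm u = 1" "X - D = s *\<^sub>R u" using * by (simp_all add: u_def)
  moreover have "s * (1 - m \<bullet> u) = l"
    using s_def unfolding \<open>X - D = s *\<^sub>R u\<close> by (simp add: algebra_simps)
  moreover from this have "m \<bullet> u \<noteq> 1" "s = l / (1 - m \<bullet> u)"
    using assms by (auto simp: nonzero_eq_divide_eq)
  ultimately show "\<exists>u. norm u = 1 \<and> m \<bullet> u \<noteq> 1 \<and> X = D + (l / (1 - m \<bullet> u)) *\<^sub>R u"
    by (intro exI [of _ u]) (metis add.commute diff_add_cancel)
next
  assume "\<exists>u. norm u = 1 \<and> m \<bullet> u \<noteq> 1 \<and> X = D + (l / (1 - m \<bullet> u)) *\<^sub>R u"
  then obtain u where u: "norm u = 1" "m \<bullet> u \<noteq> 1" "X = D + (l / (1 - m \<bullet> u)) *\<^sub>R u" by blast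
  have "l + m \<bullet> (X - D) = l / (1 - m \<bullet> u)" using u(2) by (simp add: u(3) field_simps)
  moreover have "dist X D = \<bar>l / (1 - m \<bullet> u)\<bar>" by (simp add: u dist_norm)
  ultimately show "X \<in> focal_conic D l m" by (simp add: focal_conic_def power_divide)
qed

section \<open>Poles of tangents and asymptotes\<close>

text \<open>The definition of touching only speaks of points of the curve near \<open>T\<close>; a differentiable path in
  the curve turns it into a statement about the velocity. Where the path returns to
  \<open>T\<close>, the quotient is \<open>0 / 0 = 0\<close>, so it still tends to \<open>0\<close> along the path.\<close>

lemma touches_at_velocity:
  fixes \<gamma> :: "real \<Rightarrow> point"
  assumes n: "n \<noteq> 0" and L: "L = {X. n \<bullet> X = b}" and touch: "touches_at L G T"
    and \<gamma>: "(\<gamma> has_vector_derivative v) (at 0)" "\<gamma> 0 = T" "\<forall>\<^sub>F t in at 0. \<gamma> t \<in> G"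
  shows "n \<bullet> v = 0"
proof -
  define r where "r = (\<lambda>X. infdist X L / dist X T)"
  have T: "n \<bullet> T = b" using touch L by (simp add: touches_at_def)
  have "(r \<longlongrightarrow> 0) (at T within G)" using touch by (simp add: touches_at_def r_def)
  then have cont: "continuous (at T within G) r" by (simp add: continuous_within r_def)
  have "(\<gamma> \<longlongrightarrow> T) (at 0)"
    using has_vector_derivative_continuous [OF \<gamma>(1)] \<gamma>(2) by (simp add: continuous_within)
  from continuous_within_tendsto_compose [OF cont \<gamma>(3) this]
  have r0: "((\<lambda>t. r (\<gamma> t)) \<longlongrightarrow> 0) (at 0)" by (simp add: r_def)
  have q: "((\<lambda>t. (1 / t) *\<^sub>R (\<gamma> t - T)) \<longlongrightarrow> v) (at 0)"
  proof -
    have "((\<lambda>t. norm (\<gamma> t - T - t *\<^sub>R v) / norm t) \<longlongrightarrow> 0) (at 0)"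
      using \<gamma>(1,2) by (simp add: has_vector_derivative_def has_derivative_at)
    moreover have "norm ((1 / t) *\<^sub>R (\<gamma> t - T) - v) = norm (\<gamma> t - T - t *\<^sub>R v) / norm t"
      if "t \<noteq> 0" for t
    proof -
      have "(1 / t) *\<^sub>R (\<gamma> t - T) - v = (1 / t) *\<^sub>R (\<gamma> t - T - t *\<^sub>R v)"
        using that by (simp add: scaleR_diff_right)
      then show ?thesis by simp
    qed
    ultimately have "((\<lambda>t. norm ((1 / t) *\<^sub>R (\<gamma> t - T) - v)) \<longlongrightarrow> 0) (at 0)"
      by (subst Lim_cong_within [OF refl refl refl]) auto
    then show ?thesis by (rule LIM_zero_cancel [OF tendsto_norm_zero_cancel])
  qed
  have eq: "\<bar>n \<bullet> ((1 / t) *\<^sub>R (\<gamma> t - T))\<bar> = norm n * r (\<gamma> t) * norm ((1 / t) *\<^sub>R (\<gamma> t - T))" for t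
  proof (cases "\<gamma> t = T")
    case False
    have a: "r (\<gamma> t) * norm n * dist (\<gamma> t) T = \<bar>n \<bullet> \<gamma> t - b\<bar>"
      using False n by (simp add: r_def L infdist_level_set)
    have b: "\<bar>n \<bullet> ((1 / t) *\<^sub>R (\<gamma> t - T))\<bar> = \<bar>1 / t\<bar> * \<bar>n \<bullet> \<gamma> t - b\<bar>"
      by (simp only: inner_scaleR_right abs_mult inner_diff_right T)
    have "\<bar>n \<bullet> ((1 / t) *\<^sub>R (\<gamma> t - T))\<bar> =
        norm n * r (\<gamma> t) * (\<bar>1 / t\<bar> * dist (\<gamma> t) T)"
      unfolding b a [symmetric] by (simp only: ac_simps)
    then show ?thesis by (simp only: norm_scaleR dist_norm)
  qed (simp add: T)
  have lim1: "((\<lambda>t. \<bar>n \<bullet> ((1 / t) *\<^sub>R (\<gamma> t - T))\<bar>) \<longlongrightarrow> norm n * 0 * norm v) (at 0)"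
    unfolding eq by (intro tendsto_intros r0 q)
  have lim2: "((\<lambda>t. \<bar>n \<bullet> ((1 / t) *\<^sub>R (\<gamma> t - T))\<bar>) \<longlongrightarrow> \<bar>n \<bullet> v\<bar>) (at 0)"
    by (intro tendsto_intros q)
  have "\<bar>n \<bullet> v\<bar> = norm n * 0 * norm v"
    by (rule tendsto_unique [OF at_neq_bot lim2 lim1])
  then show ?thesis by simp
qed

text \<open>The poles of the tangents form a circle: they are the \<open>n\<close> with \<open>norm (l n + m) = 1\<close>. At the contact
  point with direction \<open>u0\<close>, incidence says \<open>N \<bullet> u0 = 1\<close> for \<open>N = l n + m\<close>. If \<open>N \<noteq> u0\<close>, turning
  \<open>u0\<close> towards \<open>N\<close> moves the point off the line with nonzero speed.\<close>

lemma touching_line_pole: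
  assumes "l \<noteq> 0" "n \<noteq> 0" and L: "L = {X. n \<bullet> (X - D) = 1}"
    and touch: "touches_at L (focal_conic D l m) T"
  shows "norm (l *\<^sub>R n + m) = 1"
proof (rule ccontr)
  define N where "N = l *\<^sub>R n + m"
  assume "norm (l *\<^sub>R n + m) \<noteq> 1"
  from touch have "T \<in> focal_conic D l m" "n \<bullet> (T - D) = 1" by (auto simp: touches_at_def L)
  then obtain u0 where u0: "norm u0 = 1" "m \<bullet> u0 \<noteq> 1" "T = D + (l / (1 - m \<bullet> u0)) *\<^sub>R u0"
    using focal_conic_polar [OF assms(1)] by blast
  have nu: "l * (n \<bullet> u0) = 1 - m \<bullet> u0"
    using \<open>n \<bullet> (T - D) = 1\<close> u0(2) by (simp add: u0(3) field_simps)
  then have Nu: "N \<bullet> u0 = 1" by (simp add: N_def inner_add_left)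
  \<comment> \<open>The direction orthogonal to \<open>u0\<close> in which \<open>u0\<close> turns towards \<open>N\<close>.\<close>
  define w where "w = sgn (N - u0)"
  have "N \<noteq> u0" using u0(1) \<open>norm (l *\<^sub>R n + m) \<noteq> 1\<close> by (auto simp: N_def)
  then have w: "norm w = 1" by (simp add: w_def norm_sgn)
  have "u0 \<bullet> u0 = 1" using u0(1) by (simp add: norm_eq_1)
  then have wu: "w \<bullet> u0 = 0" using Nu by (simp add: w_def sgn_div_norm inner_diff_left)
  have "w \<bullet> (N - u0) \<noteq> 0" using \<open>N \<noteq> u0\<close> by (simp add: w_def sgn_div_norm)
  then have Nw: "N \<bullet> w \<noteq> 0" using wu by (simp add: inner_diff_right inner_commute)
  define u where "u t = cos t *\<^sub>R u0 + sin t *\<^sub>R w" for t :: real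
  define \<gamma> where "\<gamma> t = D + (l / (1 - m \<bullet> u t)) *\<^sub>R u t" for t
  define v where "v = (l * (m \<bullet> w) / (1 - m \<bullet> u0)^2) *\<^sub>R u0 + (l / (1 - m \<bullet> u0)) *\<^sub>R w"
  have unit: "norm (u t) = 1" for t
  proof -
    have "u t \<bullet> u t = (cos t)^2 * (u0 \<bullet> u0) + (sin t)^2 * (w \<bullet> w)"
      using wu by (simp add: u_def inner_add_left inner_add_right inner_commute power2_eq_square)
    then show ?thesis using \<open>u0 \<bullet> u0 = 1\<close> w by (simp add: norm_eq_1)
  qed
  have du: "(u has_vector_derivative w) (at 0)"
    unfolding u_def by (auto intro!: derivative_eq_intros)
  have dm: "((\<lambda>t. m \<bullet> u t) has_real_derivative m \<bullet> w) (at 0)"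
    using bounded_linear.has_vector_derivative [OF bounded_linear_inner_right du, of m]
    by (simp add: has_real_derivative_iff_has_vector_derivative)
  have "u 0 = u0" by (simp add: u_def)
  then have nz: "1 - m \<bullet> u 0 \<noteq> 0" using u0(2) by simp
  have "((\<lambda>t. l / (1 - m \<bullet> u t)) has_real_derivative l * (m \<bullet> w) / (1 - m \<bullet> u0)^2) (at 0)"
    using nz by (auto intro!: derivative_eq_intros dm simp: \<open>u 0 = u0\<close> power2_eq_square)
  from has_vector_derivative_scaleR [OF this du]
  have "((\<lambda>t. (l / (1 - m \<bullet> u t)) *\<^sub>R u t) has_vector_derivative v) (at 0)"
    by (simp add: v_def \<open>u 0 = u0\<close> add.commute)
  then have "(\<gamma> has_vector_derivative v) (at 0)"
    using has_vector_derivative_add [OF has_vector_derivative_const, of _ v "at 0" D]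
    unfolding \<gamma>_def by simp
  moreover have "\<gamma> 0 = T" by (simp add: \<gamma>_def u_def u0(3))
  moreover have "\<forall>\<^sub>F t in at 0. \<gamma> t \<in> focal_conic D l m"
  proof -
    have "((\<lambda>t. m \<bullet> u t) \<longlongrightarrow> m \<bullet> u 0) (at 0)"
      using DERIV_isCont [OF dm] by (simp add: isCont_def)
    moreover have "m \<bullet> u 0 \<noteq> 1" using nz by simp
    ultimately have "\<forall>\<^sub>F t in at 0. m \<bullet> u t \<noteq> 1" by (rule tendsto_imp_eventually_ne)
    then show ?thesis
      by eventually_elim (use unit focal_conic_polar [OF assms(1)] in \<open>auto simp: \<gamma>_def\<close>)
  qed
  moreover have "L = {X. n \<bullet> X = 1 + n \<bullet> D}" by (auto simp: L inner_diff_right)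
  ultimately have "n \<bullet> v = 0" using touches_at_velocity assms(2) touch by blast
  define d where "d = 1 - m \<bullet> u0"
  have "d \<noteq> 0" using u0(2) by (simp add: d_def)
  have "n \<bullet> v = (m \<bullet> w) * (l * (n \<bullet> u0)) / d^2 + l * (n \<bullet> w) / d"
    by (simp add: v_def d_def inner_add_right)
  also have "\<dots> = (m \<bullet> w + l * (n \<bullet> w)) / d"
    using \<open>d \<noteq> 0\<close> unfolding nu d_def [symmetric] by (simp add: power2_eq_square add_divide_distrib)
  finally have "m \<bullet> w + l * (n \<bullet> w) = 0" using \<open>n \<bullet> v = 0\<close> \<open>d \<noteq> 0\<close> by simp
  then show False using Nw by (simp add: N_def inner_add_left)
qed

lemma focal_conic_nonempty:
  assumes "l \<noteq> 0"
  shows "focal_conic D l m \<noteq> {}"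
proof -
  obtain u where u: "u \<noteq> 0" "orthogonal m u" using orthogonal_to_vector_exists [of m] by auto
  then have "m \<bullet> sgn u = 0" "norm (sgn u) = 1"
    by (simp_all add: orthogonal_def sgn_div_norm)
  then have "D + l *\<^sub>R sgn u \<in> focal_conic D l m"
    using focal_conic_polar [OF assms, of "D + l *\<^sub>R sgn u" D m] by force
  then show ?thesis by blast
qed

lemma closed_focal_conic: "closed (focal_conic D l m)"
  unfolding focal_conic_def by (intro closed_Collect_eq continuous_intros)

text \<open>Follow the line \<open>D + p + k v\<close> for \<open>k\<close> to infinity and compare with the nearest points
  \<open>D + p + k v + e k\<close> of the conic. As \<open>e k\<close> tends to \<open>0\<close>, the coefficients of \<open>k^2\<close> and \<open>k\<close> in the equation
  of the conic must vanish: \<open>(m \<bullet> v)^2 = 1\<close> and \<open>l + m \<bullet> p = 0\<close>. Thus \<open>l n + m\<close> is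
  \<open>v\<close> or \<open>- v\<close>.\<close>

lemma asymptote_pole:
  assumes "l \<noteq> 0" "n \<noteq> 0" and L: "L = {X. n \<bullet> (X - D) = 1}"
    and asym: "asymptote_of L (focal_conic D l m)"
  shows "norm (l *\<^sub>R n + m) = 1"
proof -
  obtain v0 where v0: "v0 \<noteq> 0" "orthogonal n v0" using orthogonal_to_vector_exists [of n] by auto
  define v where "v = sgn v0"
  have v: "n \<bullet> v = 0" "norm v = 1"
    using v0 by (simp_all add: v_def orthogonal_def sgn_div_norm)
  then have vv: "v \<bullet> v = 1" by (simp add: norm_eq_1)
  define p where "p = (1 / (n \<bullet> n)) *\<^sub>R n"
  define X where "X k = D + p + real k *\<^sub>R v" for k
  have pv: "p \<bullet> v = 0" using v(1) by (simp add: p_def)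
  have XL: "X k \<in> L" for k using assms(2) v(1) by (simp add: L X_def p_def inner_add_right)
  have "filterlim X at_infinity sequentially"
  proof -
    have "filterlim (\<lambda>k. norm (real k *\<^sub>R v)) at_top sequentially"
      using v(2) filterlim_real_sequentially by simp
    then have "filterlim (\<lambda>k. real k *\<^sub>R v) at_infinity sequentially"
      by (rule filterlim_norm_at_top_imp_at_infinity)
    then show ?thesis unfolding X_def
      by (rule tendsto_add_filterlim_at_infinity [OF tendsto_const])
  qed
  then have "filterlim X (inf at_infinity (principal L)) sequentially"
    using XL by (simp add: filterlim_inf filterlim_principal)
  with asym have inf0: "(\<lambda>k. infdist (X k) (focal_conic D l m)) \<longlonglongrightarrow> 0"
    unfolding asymptote_of_def by (rule filterlim_compose)
  have "\<forall>k. \<exists>Z \<in> focal_conic D l m. infdist (X k) (focal_conic D l m) = dist (X k) Z"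
    using infdist_attains_inf [OF closed_focal_conic focal_conic_nonempty [OF assms(1)]] by metis
  then obtain Z where Z: "\<And>k. Z k \<in> focal_conic D l m"
      "\<And>k. infdist (X k) (focal_conic D l m) = dist (X k) (Z k)" by metis
  define e where "e k = Z k - X k" for k
  have "(\<lambda>k. norm (e k)) \<longlonglongrightarrow> 0" using inf0 unfolding Z(2) e_def by (simp add: dist_norm norm_minus_commute)
  then have e0: "e \<longlonglongrightarrow> 0" by (rule tendsto_norm_zero_cancel)
  define \<alpha> where "\<alpha> k = l + m \<bullet> p + m \<bullet> e k" for k
  define \<beta> where "\<beta> k = p \<bullet> p + e k \<bullet> e k + 2 * (p \<bullet> e k)" for k
  define s where "s = m \<bullet> v"
  have i0: "(\<lambda>k. 1 / real k) \<longlonglongrightarrow> 0" by (rule lim_1_over_n)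
  have \<alpha>: "\<alpha> \<longlonglongrightarrow> l + m \<bullet> p + m \<bullet> 0" unfolding \<alpha>_def by (intro tendsto_intros e0)
  have \<beta>: "\<beta> \<longlonglongrightarrow> p \<bullet> p + (0::point) \<bullet> 0 + 2 * (p \<bullet> 0)"
    unfolding \<beta>_def by (intro tendsto_add tendsto_mult tendsto_const tendsto_inner e0)
  have eq: "\<beta> k + (real k)^2 + 2 * real k * (v \<bullet> e k) = (\<alpha> k + real k * s)^2" for k
  proof -
    have ZD: "Z k - D = p + e k + real k *\<^sub>R v" by (simp add: e_def X_def)
    have "(dist (Z k) D)^2 = (l + m \<bullet> (Z k - D))^2" using Z(1) [of k] by (simp add: focal_conic_def)
    also have "l + m \<bullet> (Z k - D) = \<alpha> k + real k * s"
      unfolding ZD by (simp add: \<alpha>_def s_def inner_add_right)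
    also have "(dist (Z k) D)^2 = \<beta> k + (real k)^2 + 2 * real k * (v \<bullet> e k)"
      unfolding dist_norm ZD power2_norm_eq_inner using pv vv
      by (simp add: \<beta>_def inner_add_left inner_add_right inner_commute power2_eq_square)
    finally show ?thesis .
  qed
  \<comment> \<open>The equation of the conic at \<open>Z k\<close>, divided by \<open>k^2\<close>, and by \<open>k\<close> once the squares have cancelled.\<close>
  define quad where "quad k = (\<alpha> k)^2 * (1 / real k)^2 + 2 * \<alpha> k * s * (1 / real k)
    - \<beta> k * (1 / real k)^2 - 2 * (1 / real k) * (v \<bullet> e k)" for k
  define lin where "lin k = (\<beta> k - (\<alpha> k)^2) * (1 / real k) + 2 * (v \<bullet> e k)" for k
  have quad: "quad k = 1 - s^2" if "k > 0" for k
  proof -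
    define i where "i = 1 / real k"
    have "real k * i = 1" using that by (simp add: i_def)
    then show ?thesis using eq [of k] unfolding quad_def i_def [symmetric] by algebra
  qed
  have "\<forall>\<^sub>F k in sequentially. quad k = 1 - s^2"
    using eventually_gt_at_top [of 0] by eventually_elim (rule quad)
  moreover have "quad \<longlonglongrightarrow>
      (l + m \<bullet> p + m \<bullet> 0)^2 * 0^2 + 2 * (l + m \<bullet> p + m \<bullet> 0) * s * 0
       - (p \<bullet> p + (0::point) \<bullet> 0 + 2 * (p \<bullet> 0)) * 0^2 - 2 * 0 * (v \<bullet> 0)"
    unfolding quad_def by (intro tendsto_intros \<alpha> \<beta> i0 e0)
  then have "quad \<longlonglongrightarrow> 0" by simp
  ultimately have "(\<lambda>k. 1 - s^2) \<longlonglongrightarrow> 0" by (rule Lim_transform_eventually [rotated])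
  then have s2: "s^2 = 1" by (simp add: LIMSEQ_const_iff)
  have lin: "lin k = 2 * \<alpha> k * s" if "k > 0" for k
  proof -
    define i where "i = 1 / real k"
    have "real k * i = 1" using that by (simp add: i_def)
    then show ?thesis using eq [of k] s2 unfolding lin_def i_def [symmetric] by algebra
  qed
  have "\<forall>\<^sub>F k in sequentially. lin k = 2 * \<alpha> k * s"
    using eventually_gt_at_top [of 0] by eventually_elim (rule lin)
  moreover have "lin \<longlonglongrightarrow>
      (p \<bullet> p + (0::point) \<bullet> 0 + 2 * (p \<bullet> 0) - (l + m \<bullet> p + m \<bullet> 0)^2) * 0 + 2 * (v \<bullet> 0)"
    unfolding lin_def by (intro tendsto_intros \<alpha> \<beta> i0 e0)
  then have "lin \<longlonglongrightarrow> 0" by simp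
  ultimately have "(\<lambda>k. 2 * \<alpha> k * s) \<longlonglongrightarrow> 0" by (rule Lim_transform_eventually [rotated])
  moreover have "(\<lambda>k. 2 * \<alpha> k * s) \<longlonglongrightarrow> 2 * (l + m \<bullet> p + m \<bullet> 0) * s"
    by (intro tendsto_intros \<alpha>)
  ultimately have "2 * (l + m \<bullet> p + m \<bullet> 0) * s = 0" using LIMSEQ_unique by blast
  then have lp: "l + m \<bullet> p = 0" using s2 by auto
  define N where "N = l *\<^sub>R n + m"
  have "n \<bullet> N = (n \<bullet> n) * (l + m \<bullet> p)"
    using assms(2) by (simp add: N_def p_def inner_add_right inner_commute field_simps)
  then have "n \<bullet> N = 0" using lp by simp
  moreover have "line_through 0 v = {X. n \<bullet> X = 0}"
  proof (rule line_through_eq_level_set)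
    show "0 \<noteq> v" using v(2) by auto
  qed (use assms(2) v(1) in simp_all)
  ultimately have "N \<in> line_through 0 v" by simp
  then obtain t where t: "N = t *\<^sub>R v" by (auto simp: affine_hull_2_alt)
  have "N \<bullet> v = s" using v(1) by (simp add: N_def s_def inner_add_left)
  then have "t = s" using t vv by simp
  then have "\<bar>t\<bar> = 1" using s2 by (auto simp: power2_eq_1_iff)
  then show ?thesis using t v(2) by (simp add: N_def)
qed

lemma tangent_pole:
  assumes "l \<noteq> 0" "n \<noteq> 0" "L = {X. n \<bullet> (X - D) = 1}" "tangent_to L (focal_conic D l m)"
  shows "norm (l *\<^sub>R n + m) = 1"
  using assms touching_line_pole asymptote_pole unfolding tangent_to_def by metis

section \<open>Infertile arcs and empty intersections\<close>

text \<open>Reciprocity between the sides of the given triangle and the vertices of its negative pedal triangle: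
  \<open>n\<close> is the pole of the side \<open>VW\<close>, and \<open>X\<close> the vertex in which the perpendiculars at \<open>V\<close> and \<open>W\<close> meet. On the circle,
  \<open>(dist Q D)^2 = 2 (U - D) \<bullet> (Q - D) - k\<close>, so the quadratic condition \<open>(X - D) \<bullet> (Q - D) = (dist Q D)^2\<close>
  that the perpendicular at \<open>Q\<close> contains \<open>X\<close> becomes linear in \<open>Q\<close>.\<close>

lemma side_level_set:
  fixes U :: point
  assumes S: "S = sphere U r" and "D \<notin> S" "V \<in> S" "W \<in> S" "V \<noteq> W"
    and X: "X \<in> perpendicular_at D V" "X \<in> perpendicular_at D W"
    and k: "k = (dist U D)^2 - r^2"
    and n: "n = (1 / k) *\<^sub>R (2 *\<^sub>R (U - D) - (X - D))"
  shows "n \<noteq> 0" "line_through V W = {Z. n \<bullet> (Z - D) = 1}"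
proof -
  have "r \<ge> 0" using assms(1,3) zero_le_dist by (metis mem_sphere)
  then have "k \<noteq> 0" using assms(1,2) by (simp add: k power2_eq_iff_nonneg)
  have on: "n \<bullet> (Q - D) = 1" if "Q \<in> S" "X \<in> perpendicular_at D Q" for Q
  proof -
    have "(U - Q) \<bullet> (U - Q) = r^2" using that(1) S by (simp add: dist_norm flip: power2_norm_eq_inner)
    moreover have "(X - Q) \<bullet> (D - Q) = 0" using that(2) by (simp add: perpendicular_at_def)
    ultimately have "(2 *\<^sub>R (U - D) - (X - D)) \<bullet> (Q - D) = k"
      unfolding k dist_norm power2_norm_eq_inner by (simp add: algebra_simps inner_commute)
    then show ?thesis using \<open>k \<noteq> 0\<close> by (simp add: n)
  qed
  show "n \<noteq> 0" using on [OF assms(3) X(1)] by auto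
  have "{Z. n \<bullet> (Z - D) = 1} = {Z. n \<bullet> Z = 1 + n \<bullet> D}" by (auto simp: inner_diff_right)
  moreover have "n \<bullet> V = 1 + n \<bullet> D" "n \<bullet> W = 1 + n \<bullet> D"
    using on [OF assms(3) X(1)] on [OF assms(4) X(2)] by (simp_all add: inner_diff_right)
  ultimately show "line_through V W = {Z. n \<bullet> (Z - D) = 1}"
    using line_through_eq_level_set \<open>n \<noteq> 0\<close> assms(5) by metis
qed

text \<open>By \<open>side_level_set\<close> the pole of a side is an affine function of a vertex of the negative pedal
  triangle, and by \<open>tangent_pole\<close> the poles of the three sides lie on a circle determined by \<open>l\<close>
  and \<open>m\<close>. So the vertices lie on an explicit circle, which must be the negative pedal circle.\<close>

lemma negative_pedal_circle_of_i_conic: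
  fixes U c :: point
  assumes S: "S = sphere U r" and "{P, Q, T} \<subseteq> S" "D \<notin> S" "triangle P Q T" "triangle P' Q' T'"
    and S': "{P', Q', T'} \<subseteq> sphere c R"
    and perp: "{Q', T'} \<subseteq> perpendicular_at D P" "{T', P'} \<subseteq> perpendicular_at D Q"
      "{P', Q'} \<subseteq> perpendicular_at D T"
    and "l \<noteq> 0" and G: "G = focal_conic D l m"
    and tan: "tangent_to (line_through Q T) G" "tangent_to (line_through T P) G"
      "tangent_to (line_through P Q) G"
    and k: "k = (dist U D)^2 - r^2"
  shows "c = D + 2 *\<^sub>R (U - D) + (k / l) *\<^sub>R m" "R = \<bar>k / l\<bar>"
proof -
  define c' where "c' = D + 2 *\<^sub>R (U - D) + (k / l) *\<^sub>R m"
  have "r \<ge> 0" using assms(1,2) zero_le_dist by (metis insert_subset mem_sphere)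
  then have "k \<noteq> 0" using assms(1,3) by (simp add: k power2_eq_iff_nonneg)
  have on: "X \<in> sphere c' \<bar>k / l\<bar>"
    if "V \<in> S" "W \<in> S" "V \<noteq> W" "X \<in> perpendicular_at D V" "X \<in> perpendicular_at D W"
      "tangent_to (line_through V W) G" for V W X
  proof -
    define n where "n = (1 / k) *\<^sub>R (2 *\<^sub>R (U - D) - (X - D))"
    note side = side_level_set [OF S assms(3) that(1-5) k n_def]
    have "norm (l *\<^sub>R n + m) = 1"
      using tangent_pole [OF assms(10) side] that(6) unfolding G .
    moreover have "c' - X = (k / l) *\<^sub>R (l *\<^sub>R n + m)"
      using \<open>k \<noteq> 0\<close> assms(10) by (simp add: c'_def n_def scaleR_add_right scaleR_2)
    ultimately show ?thesis by (simp add: dist_norm)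
  qed
  note d = triangle_distinct [OF assms(4)]
  have "P' \<in> sphere c' \<bar>k / l\<bar>" by (rule on [of Q T]) (use assms(2) d perp tan in auto)
  moreover have "Q' \<in> sphere c' \<bar>k / l\<bar>" by (rule on [of T P]) (use assms(2) d perp tan in auto)
  moreover have "T' \<in> sphere c' \<bar>k / l\<bar>" by (rule on [of P Q]) (use assms(2) d perp tan in auto)
  ultimately have "c = c'" using sphere_centre_unique [OF assms(5) S', of c' "\<bar>k / l\<bar>"] by blast
  then show "c = D + 2 *\<^sub>R (U - D) + (k / l) *\<^sub>R m" by (simp add: c'_def)
  show "R = \<bar>k / l\<bar>" using \<open>P' \<in> sphere c' _\<close> S' \<open>c = c'\<close> by simp
qed

text \<open>By Cauchy--Schwarz, a common point bounds \<open>(c - X) \<bullet> (A - D)\<close> by \<open>R dist A D\<close>; since \<open>A\<close> is on the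
  circle around \<open>U\<close>, this scalar product equals \<open>(k / l) (l + m \<bullet> (A - D))\<close>, and the bound says that
  \<open>A\<close> is not inside the conic.\<close>

lemma perpendicular_misses_circle:
  fixes U c :: point
  assumes "A \<in> sphere U r" and "l \<noteq> 0" and k: "k = (dist U D)^2 - r^2"
    and c: "c = D + 2 *\<^sub>R (U - D) + (k / l) *\<^sub>R m" and R: "R = \<bar>k / l\<bar>"
    and "A \<in> focal_interior D l m" "k \<noteq> 0"
  shows "perpendicular_at D A \<inter> sphere c R = {}"
proof -
  have False if X: "X \<in> perpendicular_at D A" "X \<in> sphere c R" for X
  proof -
    have "(U - A) \<bullet> (U - A) = r^2"
      using assms(1) by (simp add: dist_norm flip: power2_norm_eq_inner)
    moreover have "(X - A) \<bullet> (D - A) = 0" using X(1) by (simp add: perpendicular_at_def)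
    ultimately have "(2 *\<^sub>R (U - D) - (X - D)) \<bullet> (A - D) = k"
      unfolding k dist_norm power2_norm_eq_inner by (simp add: algebra_simps inner_commute)
    moreover have "c - X = 2 *\<^sub>R (U - D) - (X - D) + (k / l) *\<^sub>R m" by (simp add: c)
    ultimately have "(c - X) \<bullet> (A - D) = k + (k / l) * (m \<bullet> (A - D))"
      by (simp only: inner_add_left inner_scaleR_left)
    then have "(c - X) \<bullet> (A - D) = (k / l) * (l + m \<bullet> (A - D))"
      using assms(2) by (simp add: field_simps)
    moreover have "((c - X) \<bullet> (A - D))^2 \<le> (norm (c - X))^2 * (norm (A - D))^2"
      unfolding power2_norm_eq_inner by (rule Cauchy_Schwarz_ineq)
    moreover have "norm (c - X) = \<bar>k / l\<bar>" using X(2) by (simp add: dist_norm R)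
    ultimately have "(k / l)^2 * (l + m \<bullet> (A - D))^2 \<le> (k / l)^2 * (dist A D)^2"
      by (simp add: power_mult_distrib dist_norm power_divide)
    then have "(l + m \<bullet> (A - D))^2 \<le> (dist A D)^2"
      using assms(2,7) by (simp add: mult_le_cancel_left_pos)
    then show False using assms(6) by (simp add: focal_interior_def)
  qed
  then show ?thesis by blast
qed

text \<open>The circle with diameter \<open>XD\<close> passes through \<open>D\<close> and therefore differs from \<open>S\<close>, with which it
  already shares \<open>A\<close>.\<close>

lemma second_intersection_unique:
  assumes S: "S = sphere U r" and "D \<notin> S" "A \<in> S" "X \<in> perpendicular_at D A"
    and "C \<in> circle_with_diameter X D \<inter> S - {A}" "C' \<in> circle_with_diameter X D \<inter> S - {A}"
  shows "C = C'"
proof (rule ccontr)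
  assume "C \<noteq> C'"
  have "A \<in> circle_with_diameter X D" using assms(4) by (simp add: in_circle_with_diameter)
  then have on: "{A, C, C'} \<subseteq> sphere (midpoint X D) (dist X D / 2)" "{A, C, C'} \<subseteq> sphere U r"
    using assms by (auto simp: circle_with_diameter_def)
  have "triangle A C C'"
    using distinct_points_on_circle_triangle [of A U r C C'] on(2) assms(5,6) \<open>C \<noteq> C'\<close> by auto
  then have "midpoint X D = U" using sphere_centre_unique on by blast
  moreover have "dist X D / 2 = r" using on calculation by auto
  moreover have "D \<in> sphere (midpoint X D) (dist X D / 2)" by (simp add: dist_midpoint)
  ultimately show False using S assms(2) by simp
qed

text \<open>An empty intersection for one choice of points rules out every choice: \<open>B'\<close> and \<open>C'\<close> are determined
  up to their order, and then \<open>B\<close> and \<open>C\<close> are determined.\<close>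

lemma empty_intersection_stops_process:
  assumes S: "S = sphere U r" "D \<notin> S" "A \<in> S"
    and empty: "some_intersection_empty D S S\<^sub>D A"
  shows "process_stops D S S\<^sub>D A"
  unfolding process_stops_def
proof (safe)
  fix B' C' B C A'
  assume con: "construction D S S\<^sub>D A B' C' B C A'"
  have BC: "perpendicular_at D A \<inter> S\<^sub>D = {B', C'}"
    "C \<in> circle_with_diameter B' D \<inter> S - {A}" "B \<in> circle_with_diameter C' D \<inter> S - {A}"
    "line_through B C' \<inter> line_through C B' = {A'}"
    using con unfolding construction_def by blast+
  then have perp: "B' \<in> perpendicular_at D A" "C' \<in> perpendicular_at D A" by blast+
  have C: "C1 = C" if "C1 \<in> circle_with_diameter B' D \<inter> S - {A}" for C1
    using second_intersection_unique [OF S perp(1) that BC(2)] .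
  have B: "B1 = B" if "B1 \<in> circle_with_diameter C' D \<inter> S - {A}" for B1
    using second_intersection_unique [OF S perp(2) that BC(3)] .
  from empty BC(1) obtain B1' C1' where 1: "{B', C'} = {B1', C1'}"
    and 2: "circle_with_diameter B1' D \<inter> S - {A} = {} \<or> circle_with_diameter C1' D \<inter> S - {A} = {} \<or>
      (\<exists>C1 \<in> circle_with_diameter B1' D \<inter> S - {A}. \<exists>B1 \<in> circle_with_diameter C1' D \<inter> S - {A}.
         line_through B1 C1' \<inter> line_through C1 B1' = {})"
    unfolding some_intersection_empty_def by (metis insert_not_empty)
  from 1 consider "B1' = B'" "C1' = C'" | "B1' = C'" "C1' = B'" by (auto simp: doubleton_eq_iff)
  then show False
  proof cases
    case 1
    then have "line_through B C' \<inter> line_through C B' = {}" using 2 BC(2,3) B C by (metis empty_iff)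
    then show False using BC(4) by simp
  next
    case 2
    note eq = this
    then have "line_through C B' \<inter> line_through B C' = {}"
      using \<open>circle_with_diameter B1' D \<inter> S - {A} = {} \<or> _\<close> BC(2,3) B C by (metis empty_iff)
    then show False using BC(4) by (simp add: Int_commute)
  qed
qed

theorem mainTheorem7:
  fixes P Q R P\<^sub>D Q\<^sub>D R\<^sub>D D A :: "real^2"
    and S S\<^sub>D :: "(real^2) set"
  assumes "circumcircle_of S P Q R"
    and "D \<notin> line_through Q R" and "D \<notin> line_through R P" and "D \<notin> line_through P Q"
    and "D \<notin> S"
    and "negative_pedal_triangle D P Q R P\<^sub>D Q\<^sub>D R\<^sub>D"
    and "circumcircle_of S\<^sub>D P\<^sub>D Q\<^sub>D R\<^sub>D"
    and "A \<in> S"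
  shows
    "(\<forall>B' C' B C A'. construction D S S\<^sub>D A B' C' B C A' \<longrightarrow>
        negative_pedal_triangle D A B C A' B' C' \<and>
        pedal_triangle D A' B' C' A B C \<and>
        circumcircle_of S\<^sub>D A' B' C' \<and>
        negative_pedal_circle D A B C S\<^sub>D \<and>
        pedal_circle D A' B' C' S) \<and>
     (some_intersection_empty D S S\<^sub>D A \<longrightarrow> process_stops D S S\<^sub>D A) \<and>
     (\<forall>G Fs I. i_conic D P Q R G Fs \<and> infertile_arc S G Fs I \<and> A \<in> I \<longrightarrow>
        some_intersection_empty D S S\<^sub>D A)"
proof (intro conjI allI impI)
  obtain U r where S: "S = sphere U r" "r > 0" using circumcircle_as_sphere [OF assms(1)] .
  obtain c \<rho> where S\<^sub>D: "S\<^sub>D = sphere c \<rho>" "\<rho> > 0" using circumcircle_as_sphere [OF assms(7)] .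
  have tri: "triangle P Q R" "{P, Q, R} \<subseteq> S" "triangle P\<^sub>D Q\<^sub>D R\<^sub>D" "{P\<^sub>D, Q\<^sub>D, R\<^sub>D} \<subseteq> S\<^sub>D"
    using assms(1,7) by (auto simp: circumcircle_of_def)
  note perp = negative_pedal_incident [OF assms(6)]
  {
    fix B' C' B C A'
    assume con: "construction D S S\<^sub>D A B' C' B C A'"
    have euler: "of_real ((2 * r / \<rho>)^2) =
        (1 - chart c \<rho> D * cnj (2 * chart c \<rho> U - chart c \<rho> D)) *
        (1 - (2 * chart c \<rho> U - chart c \<rho> D) * cnj (chart c \<rho> D))"
      by (rule inscribed_triangle_euler_relation [OF S\<^sub>D(2) _ _ tri(3) _ perp refl refl])
        (use assms(5) tri S(1) S\<^sub>D(1) in simp_all)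
    have npt: "negative_pedal_triangle D A B C A' B' C'" and "A' \<in> S\<^sub>D" "{B, C} \<subseteq> S"
      using construction_closes [OF S(1) S\<^sub>D(1) S(2) S\<^sub>D(2) assms(5,8) refl refl euler con] by auto
    show "negative_pedal_triangle D A B C A' B' C'" by (rule npt)
    show pt: "pedal_triangle D A' B' C' A B C" by (rule negative_pedal_imp_pedal [OF npt])
    have "B' \<in> S\<^sub>D" "C' \<in> S\<^sub>D" using con unfolding construction_def by blast+
    then show circ: "circumcircle_of S\<^sub>D A' B' C'"
      using npt \<open>A' \<in> S\<^sub>D\<close> S\<^sub>D(1) by (auto simp: circumcircle_of_def negative_pedal_triangle_def)
    show "negative_pedal_circle D A B C S\<^sub>D"
      using npt circ unfolding negative_pedal_circle_def by blast
    have "circumcircle_of S A B C"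
      using npt \<open>{B, C} \<subseteq> S\<close> assms(8) S(1) by (auto simp: circumcircle_of_def negative_pedal_triangle_def)
    then show "pedal_circle D A' B' C' S" using pt unfolding pedal_circle_def by blast
  }
  show "process_stops D S S\<^sub>D A" if "some_intersection_empty D S S\<^sub>D A"
    using empty_intersection_stops_process [OF S(1) assms(5,8) that] .
  fix G Fs I
  assume *: "i_conic D P Q R G Fs \<and> infertile_arc S G Fs I \<and> A \<in> I"
  then have G: "conic_with_foci G Fs" "D \<in> Fs" and tan: "tangent_to (line_through Q R) G"
      "tangent_to (line_through R P) G" "tangent_to (line_through P Q) G"
    by (auto simp: i_conic_def)
  obtain l m where lm: "l \<noteq> 0" "G = focal_conic D l m" "Fs \<subseteq> focal_interior D l m"
    using conic_focal_form [OF G] .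
  have "A \<in> inside_conic G Fs" using * by (auto simp: infertile_arc_def)
  then have A: "A \<in> focal_interior D l m"
    using inside_conic_subset_focal_interior [OF lm(3)] lm(2) by blast
  define k where "k = (dist U D)^2 - r^2"
  have "k \<noteq> 0" using S assms(5) by (simp add: k_def power2_eq_iff_nonneg)
  have "c = D + 2 *\<^sub>R (U - D) + (k / l) *\<^sub>R m" "\<rho> = \<bar>k / l\<bar>"
    using negative_pedal_circle_of_i_conic
      [OF S(1) tri(2) assms(5) tri(1,3) _ perp lm(1,2) tan k_def, of c \<rho>] tri(4) S\<^sub>D(1) by auto
  then have "perpendicular_at D A \<inter> S\<^sub>D = {}"
    using perpendicular_misses_circle [OF _ lm(1) k_def _ _ A \<open>k \<noteq> 0\<close>] assms(8) S(1) S\<^sub>D(1) by blast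
  then show "some_intersection_empty D S S\<^sub>D A" by (simp add: some_intersection_empty_def)
qed

end
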